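(* Let $X$ be a set, $\Lambda$ a uniform Banach space, $\mathcal{B}$ a $\Lambda$-valued RKBS on $X$ with reproducing kernel $K$, $m\in\mathbb{N}$, $\mathbf{x}=(x_1,\dots,x_m)\in X^m$, $Q:\Lambda^m\to\mathbb{R}_+$, $\Psi:\mathbb{R}_+\to\mathbb{R}_+$ and $\lambda>0$. Write $f(\mathbf{x}):=(f(x_1),\dots,f(x_m))$ and suppose that $$\inf_{f\in\mathcal{B}}Q(f(\mathbf{x}))+\lambda\Psi(\|f\|_{\mathcal{B}})\qquad(\ast)$$ has at least one minimizer. If $\Psi$ is nondecreasing, then $(\ast)$ has a minimizer $f_0$ that satisfies $$f_0^*\in\overline{\operatorname{span}}\{(K(x_j,\cdot)\xi)^*:1\le j\le m,\ \xi\in\Lambda\}.\qquad(\ast\ast)$$ If $\Psi$ is strictly increasing, then every minimizer $f_0$ of $(\ast)$ must satisfy $(\ast\ast)$.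
   Context: Banach spaces are over $\mathbb{C}$; $\mathbb{R}_+:=[0,\infty)$. A semi-inner product on a Banach space $V$ is a function $[\cdot,\cdot]_V:V\times V\to\mathbb{C}$ that is linear in its first variable, conjugate homogeneous in its second ($[f,\alpha g]_V=\overline{\alpha}[f,g]_V$), positive ($[f,f]_V>0$ for $f\neq0$), and satisfies $|[f,g]_V|\le[f,f]_V^{1/2}[g,g]_V^{1/2}$. It is compatible if $[f,f]_V^{1/2}=\|f\|_V$ for all $f\in V$. $V$ is uniformly convex if for all $\varepsilon>0$ there is $\delta>0$ with $\|f+g\|_V\le2-\delta$ whenever $\|f\|_V=\|g\|_V=1$ and $\|f-g\|_V\ge\varepsilon$. $V$ is uniformly Fréchet differentiable if $\lim_{t\in\mathbb{R},t\to0}(\|f+tg\|_V-\|f\|_V)/t$ exists uniformly over $f,g$ in the unit sphere of $V$. $V$ is called uniform if it is both uniformly convex and uniformly Fréchet differentiable. A uniform Banach space $V$ has a unique compatible semi-inner product (Giles), always denoted $[\cdot,\cdot]_V$; for $f\in V$, $f^*\in V^*$ denotes the functional $f^*(g)=[g,f]_V$. A $\Lambda$-valued RKBS on $X$ is a Banach space $\mathcal{B}$ consisting of functions from $X$ to $\Lambda$, with both $\mathcal{B}$ and $\Lambda$ uniform, such that $\|f\|_{\mathcal{B}}=0$ iff $f(x)=0$ for all $x\in X$, and such that for every $x\in X$ the point evaluation $f\mapsto f(x)$ is continuous from $\mathcal{B}$ to $\Lambda$. $\mathcal{M}(\Lambda)$ is the set of all (not necessarily linear) maps $T:\Lambda\to\Lambda$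 for which there is $\alpha\ge0$ with $\|Tu\|_\Lambda\le\alpha\|u\|_\Lambda$ for all $u$. The reproducing kernel of $\mathcal{B}$ is the unique function $K:X\times X\to\mathcal{M}(\Lambda)$ such that $K(x,\cdot)\xi\in\mathcal{B}$ and $[f(x),\xi]_\Lambda=[f,K(x,\cdot)\xi]_{\mathcal{B}}$ for all $f\in\mathcal{B}$, $x\in X$, $\xi\in\Lambda$, where $K(x,\cdot)\xi$ denotes the function $y\mapsto K(x,y)\xi$. The closed span is taken in the norm of $\mathcal{B}^*$. *)

theory Defs
  imports "HOL-Analysis.Analysis" "HOL-Library.Function_Algebras"
begin

class scaleC =
  fixes scaleC :: "complex \<Rightarrow> 'a \<Rightarrow> 'a"  (infixr \<open>*\<^sub>C\<close> 75)

class complex_vector = scaleC + ab_group_add +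
  assumes scaleC_add_right: "a *\<^sub>C (x + y) = a *\<^sub>C x + a *\<^sub>C y"
    and scaleC_add_left: "(a + b) *\<^sub>C x = a *\<^sub>C x + b *\<^sub>C x"
    and scaleC_scaleC: "a *\<^sub>C b *\<^sub>C x = (a * b) *\<^sub>C x"
    and scaleC_one: "1 *\<^sub>C x = x"

global_interpretation complex_vector:
  vector_space "scaleC :: complex \<Rightarrow> 'a \<Rightarrow> 'a::complex_vector"
  by unfold_locales
    (fact scaleC_add_right scaleC_add_left scaleC_scaleC scaleC_one)+

class complex_banach = complex_vector + banach +
  assumes scaleR_scaleC: "scaleR r x = complex_of_real r *\<^sub>C x"
    and norm_scaleC: "norm (a *\<^sub>C x) = cmod a * norm x"

instantiation complex :: complex_banach
begin
definition scaleC_complex_def: "a *\<^sub>C (z::complex) = a * z"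
instance
  by standard
    (simp_all add: scaleC_complex_def algebra_simps norm_mult scaleR_conv_of_real)
end

instantiation "fun" :: (type, complex_vector) complex_vector
begin
definition scaleC_fun_def: "a *\<^sub>C f = (\<lambda>x. a *\<^sub>C f x)"
instance
  by standard
    (simp_all add: scaleC_fun_def fun_eq_iff scaleC_add_right scaleC_add_left
      scaleC_scaleC scaleC_one)
end


text \<open>
  A normed space is given by a carrier V inside an ambient complex vector space and a function N
  whose values matter on V only. A Banach space of functions is thus a set of functions with
  pointwise operations, and a complex Banach type is the special case V = UNIV, N = norm.
\<close>

text \<open>
  The value 0 outside V is needed because Metric_space demands nonnegativity and symmetry of the
  distance function everywhere, not just on its carrier.
\<close>

definition norm_dist :: "'v::complex_vector set \<Rightarrow> ('v \<Rightarrow> real) \<Rightarrow> 'v \<Rightarrow> 'v \<Rightarrow> real" where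
  "norm_dist V N f g = (if f \<in> V \<and> g \<in> V then N (f - g) else 0)"

definition norm_topology :: "'v::complex_vector set \<Rightarrow> ('v \<Rightarrow> real) \<Rightarrow> 'v topology" where
  "norm_topology V N = Metric_space.mtopology V (norm_dist V N)"

definition normed_space_on :: "'v::complex_vector set \<Rightarrow> ('v \<Rightarrow> real) \<Rightarrow> bool" where
  "normed_space_on V N \<longleftrightarrow>
     complex_vector.subspace V \<and>
     (\<forall>f\<in>V. 0 \<le> N f \<and> (N f = 0 \<longleftrightarrow> f = 0)) \<and>
     (\<forall>f\<in>V. \<forall>a. N (a *\<^sub>C f) = cmod a * N f) \<and>
     (\<forall>f\<in>V. \<forall>g\<in>V. N (f + g) \<le> N f + N g)"

definition banach_space_on :: "'v::complex_vector set \<Rightarrow> ('v \<Rightarrow> real) \<Rightarrow> bool" where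
  "banach_space_on V N \<longleftrightarrow>
     normed_space_on V N \<and> Metric_space.mcomplete V (norm_dist V N)"

definition uniformly_convex_on :: "'v::complex_vector set \<Rightarrow> ('v \<Rightarrow> real) \<Rightarrow> bool" where
  "uniformly_convex_on V N \<longleftrightarrow>
     (\<forall>\<epsilon>>0. \<exists>\<delta>>0. \<forall>f\<in>V. \<forall>g\<in>V.
        N f = 1 \<longrightarrow> N g = 1 \<longrightarrow> N (f - g) \<ge> \<epsilon> \<longrightarrow> N (f + g) \<le> 2 - \<delta>)"

definition uniformly_frechet_differentiable_on ::
    "'v::complex_vector set \<Rightarrow> ('v \<Rightarrow> real) \<Rightarrow> bool" where
  "uniformly_frechet_differentiable_on V N \<longleftrightarrow>
     (let S = {f \<in> V. N f = 1} in
      \<exists>L. uniform_limit (S \<times> S)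
            (\<lambda>t (f, g). (N (f + complex_of_real t *\<^sub>C g) - N f) / t) L (at (0::real)))"

definition uniform_banach_space :: "'v::complex_vector set \<Rightarrow> ('v \<Rightarrow> real) \<Rightarrow> bool" where
  "uniform_banach_space V N \<longleftrightarrow>
     banach_space_on V N \<and> uniformly_convex_on V N \<and> uniformly_frechet_differentiable_on V N"


definition semi_inner_product_on ::
    "'v::complex_vector set \<Rightarrow> ('v \<Rightarrow> 'v \<Rightarrow> complex) \<Rightarrow> bool" where
  "semi_inner_product_on V s \<longleftrightarrow>
     (\<forall>f\<in>V. \<forall>g\<in>V. \<forall>h\<in>V. s (f + g) h = s f h + s g h) \<and>
     (\<forall>f\<in>V. \<forall>g\<in>V. \<forall>a. s (a *\<^sub>C f) g = a * s f g) \<and>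
     (\<forall>f\<in>V. \<forall>g\<in>V. \<forall>a. s f (a *\<^sub>C g) = cnj a * s f g) \<and>
     (\<forall>f\<in>V. f \<noteq> 0 \<longrightarrow> s f f \<in> \<real> \<and> 0 < Re (s f f)) \<and>
     (\<forall>f\<in>V. \<forall>g\<in>V. cmod (s f g) \<le> sqrt (Re (s f f)) * sqrt (Re (s g g)))"

definition compatible_sip_on ::
    "'v::complex_vector set \<Rightarrow> ('v \<Rightarrow> real) \<Rightarrow> ('v \<Rightarrow> 'v \<Rightarrow> complex) \<Rightarrow> bool" where
  "compatible_sip_on V N s \<longleftrightarrow>
     semi_inner_product_on V s \<and> (\<forall>f\<in>V. sqrt (Re (s f f)) = N f)"

text \<open>
  On a uniform Banach space the compatible semi-inner product is unique as a function on V x V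
  (Giles). Extension by 0 outside V makes it unique as a HOL function, so that the description
  below denotes.
\<close>

definition sip :: "'v::complex_vector set \<Rightarrow> ('v \<Rightarrow> real) \<Rightarrow> 'v \<Rightarrow> 'v \<Rightarrow> complex" where
  "sip V N = (THE s. compatible_sip_on V N s \<and> (\<forall>f g. f \<notin> V \<or> g \<notin> V \<longrightarrow> s f g = 0))"


text \<open>
  Functionals on V are represented by their extension by 0 outside V, so that pointwise
  equality and addition of HOL functions agree with those of functionals on V.
\<close>

definition dual_space :: "'v::complex_vector set \<Rightarrow> ('v \<Rightarrow> real) \<Rightarrow> ('v \<Rightarrow> complex) set" where
  "dual_space V N =
     {\<phi>. (\<forall>f\<in>V. \<forall>g\<in>V. \<phi> (f + g) = \<phi> f + \<phi> g) \<and>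
         (\<forall>f\<in>V. \<forall>a. \<phi> (a *\<^sub>C f) = a * \<phi> f) \<and>
         (\<exists>C. \<forall>f\<in>V. cmod (\<phi> f) \<le> C * N f) \<and>
         (\<forall>f. f \<notin> V \<longrightarrow> \<phi> f = 0)}"

definition dual_norm ::
    "'v::complex_vector set \<Rightarrow> ('v \<Rightarrow> real) \<Rightarrow> ('v \<Rightarrow> complex) \<Rightarrow> real" where
  "dual_norm V N \<phi> = (SUP f\<in>{f \<in> V. N f \<le> 1}. cmod (\<phi> f))"

definition dual_elem ::
    "'v::complex_vector set \<Rightarrow> ('v \<Rightarrow> real) \<Rightarrow> 'v \<Rightarrow> ('v \<Rightarrow> complex)" where
  "dual_elem V N f = (\<lambda>g. sip V N g f)"

definition dual_closed_span ::
    "'v::complex_vector set \<Rightarrow> ('v \<Rightarrow> real) \<Rightarrow> ('v \<Rightarrow> complex) set \<Rightarrow> ('v \<Rightarrow> complex) set" where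
  "dual_closed_span V N S =
     norm_topology (dual_space V N) (dual_norm V N) closure_of complex_vector.span S"


definition RKBS :: "('x \<Rightarrow> 'l::complex_banach) set \<Rightarrow> (('x \<Rightarrow> 'l) \<Rightarrow> real) \<Rightarrow> bool" where
  "RKBS B N \<longleftrightarrow>
     uniform_banach_space (UNIV :: 'l set) norm \<and>
     uniform_banach_space B N \<and>
     (\<forall>f\<in>B. N f = 0 \<longleftrightarrow> (\<forall>x. f x = 0)) \<and>
     (\<forall>x. continuous_map (norm_topology B N) euclidean (\<lambda>f. f x))"

definition bounded_growth_maps :: "('l::complex_banach \<Rightarrow> 'l) set" where
  "bounded_growth_maps = {T. \<exists>\<alpha>\<ge>0. \<forall>u. norm (T u) \<le> \<alpha> * norm u}"

definition reproducing_kernel ::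
    "('x \<Rightarrow> 'l::complex_banach) set \<Rightarrow> (('x \<Rightarrow> 'l) \<Rightarrow> real) \<Rightarrow>
     ('x \<Rightarrow> 'x \<Rightarrow> 'l \<Rightarrow> 'l) \<Rightarrow> bool" where
  "reproducing_kernel B N K \<longleftrightarrow>
     (\<forall>x y. K x y \<in> bounded_growth_maps) \<and>
     (\<forall>x \<xi>. (\<lambda>y. K x y \<xi>) \<in> B) \<and>
     (\<forall>f\<in>B. \<forall>x \<xi>. sip UNIV norm (f x) \<xi> = sip B N f (\<lambda>y. K x y \<xi>))"

text \<open>Elements of \<open>X\<^sup>m\<close> and \<open>\<Lambda>\<^sup>m\<close> are lists of length m.\<close>

definition objective ::
    "('l list \<Rightarrow> real) \<Rightarrow> real \<Rightarrow> (real \<Rightarrow> real) \<Rightarrow> (('x \<Rightarrow> 'l) \<Rightarrow> real) \<Rightarrow> 'x list \<Rightarrow>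
     ('x \<Rightarrow> 'l) \<Rightarrow> real" where
  "objective Q lam \<Psi> N xs f = Q (map f xs) + lam * \<Psi> (N f)"

end

theory Submission
  imports Defs
begin

text \<open>
  Let \<open>W\<close> be the common kernel of the functionals \<open>(K(x\<^sub>j,\<cdot>)\<xi>)\<^sup>*\<close>. By the reproducing property its
  elements vanish at every \<open>x\<^sub>j\<close>, so adding one of them to \<open>f\<close> does not change the loss term.
  By uniform convexity every coset of \<open>W\<close> has an element \<open>f\<^sub>0\<close> of least norm. A minimizer can be
  replaced by the \<open>f\<^sub>0\<close> of its coset, and must be this \<open>f\<^sub>0\<close> when \<open>\<Psi>\<close> is strictly increasing.
  Differentiating the norm at \<open>f\<^sub>0\<close> shows that \<open>f\<^sub>0\<^sup>*\<close> annihilates \<open>W\<close>.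

  It remains to see that a functional \<open>\<phi>\<close> annihilating the common kernel of a subspace \<open>M\<close> of the
  dual lies in the closure of \<open>M\<close>. If its distance \<open>e\<close> from \<open>M\<close> is positive, take
  \<open>\<mu>\<^sub>n \<in> M\<close> with \<open>\<parallel>\<phi> - \<mu>\<^sub>n\<parallel> \<rightarrow> e\<close> and \<open>u\<^sub>n\<close> in the unit ball almost norming \<open>\<phi> - \<mu>\<^sub>n\<close>. Uniform
  convexity makes \<open>u\<^sub>n\<close> a Cauchy sequence, and all of \<open>M\<close> vanishes at its limit \<open>u\<close> while
  \<open>\<phi> u = e\<close>. This replaces reflexivity (Milman-Pettis).
\<close>

section \<open>Norms on a carrier: elementary estimates, closure and completeness\<close>

locale normed_carrier =
  fixes V :: "'v::complex_vector set" and N :: "'v \<Rightarrow> real"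
  assumes normed: "normed_space_on V N"
begin

lemma subspace: "complex_vector.subspace V"
  and N_nonneg: "f \<in> V \<Longrightarrow> 0 \<le> N f"
  and N_eq_0: "f \<in> V \<Longrightarrow> N f = 0 \<longleftrightarrow> f = 0"
  and N_scale: "f \<in> V \<Longrightarrow> N (a *\<^sub>C f) = cmod a * N f"
  and N_add: "f \<in> V \<Longrightarrow> g \<in> V \<Longrightarrow> N (f + g) \<le> N f + N g"
  using normed unfolding normed_space_on_def by auto

lemma zero_in [simp]: "0 \<in> V"
  and add_in [simp]: "f \<in> V \<Longrightarrow> g \<in> V \<Longrightarrow> f + g \<in> V"
  and diff_in [simp]: "f \<in> V \<Longrightarrow> g \<in> V \<Longrightarrow> f - g \<in> V"
  and scale_in [simp]: "f \<in> V \<Longrightarrow> a *\<^sub>C f \<in> V"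
  using subspace
  by (auto intro: complex_vector.subspace_0 complex_vector.subspace_add
      complex_vector.subspace_diff complex_vector.subspace_scale)

lemma N_0 [simp]: "N 0 = 0"
  using N_eq_0 by auto

lemma N_pos: "f \<in> V \<Longrightarrow> f \<noteq> 0 \<Longrightarrow> 0 < N f"
  using N_eq_0[of f] N_nonneg[of f] by linarith

lemma N_diff_commute: "f \<in> V \<Longrightarrow> g \<in> V \<Longrightarrow> N (f - g) = N (g - f)"
  using N_scale[of "f - g" "-1"] by simp

lemma N_triangle: "f \<in> V \<Longrightarrow> g \<in> V \<Longrightarrow> h \<in> V \<Longrightarrow> N (f - h) \<le> N (f - g) + N (g - h)"
  using N_add[of "f - g" "g - h"] by simp

lemma N_diff_le: "f \<in> V \<Longrightarrow> g \<in> V \<Longrightarrow> N f \<le> N g + N (f - g)"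
  using N_add[of g "f - g"] by simp

lemma N_diff: "f \<in> V \<Longrightarrow> g \<in> V \<Longrightarrow> N (f - g) \<le> N f + N g"
  using N_triangle[of f 0 g] N_diff_commute[of 0 g] by simp

lemma metric: "Metric_space V (norm_dist V N)"
proof
  fix x y z
  show "0 \<le> norm_dist V N x y" by (simp add: norm_dist_def N_nonneg)
  show "norm_dist V N x y = norm_dist V N y x"
    by (simp add: norm_dist_def N_diff_commute)
  show "x \<in> V \<Longrightarrow> y \<in> V \<Longrightarrow> norm_dist V N x y = 0 \<longleftrightarrow> x = y"
    by (simp add: norm_dist_def N_eq_0)
  show "x \<in> V \<Longrightarrow> y \<in> V \<Longrightarrow> z \<in> V \<Longrightarrow> norm_dist V N x z \<le> norm_dist V N x y + norm_dist V N y z"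
    by (simp add: norm_dist_def N_triangle)
qed

lemma closure_of_norm_topologyI:
  assumes "\<phi> \<in> V" "\<And>\<epsilon>. \<epsilon> > 0 \<Longrightarrow> \<exists>\<mu>\<in>M. \<mu> \<in> V \<and> N (\<phi> - \<mu>) < \<epsilon>"
  shows "\<phi> \<in> norm_topology V N closure_of M"
  using assms unfolding norm_topology_def Metric_space.metric_closure_of[OF metric]
  by (auto simp: Metric_space.in_mball[OF metric] norm_dist_def)

lemma complete_limit:
  assumes "Metric_space.mcomplete V (norm_dist V N)"
    and "\<And>n::nat. u n \<in> V"
    and "\<And>\<eta>. \<eta> > 0 \<Longrightarrow> \<exists>M. \<forall>m\<ge>M. \<forall>n\<ge>M. N (u m - u n) < \<eta>"
  obtains l where "l \<in> V" "(\<lambda>n. N (u n - l)) \<longlonglongrightarrow> 0"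
proof -
  interpret Metric_space V "norm_dist V N" by (rule metric)
  have "MCauchy u"
    unfolding MCauchy_def using assms(2,3) by (auto simp: norm_dist_def)
  then obtain l where "limitin mtopology u l sequentially"
    using assms(1) by (auto simp: mcomplete_def)
  then have l: "l \<in> V" "\<And>\<epsilon>. \<epsilon> > 0 \<Longrightarrow> \<exists>M. \<forall>n\<ge>M. norm_dist V N (u n) l < \<epsilon>"
    unfolding limit_metric_sequentially by blast+
  have "(\<lambda>n. N (u n - l)) \<longlonglongrightarrow> 0"
    using l assms(2) by (auto simp: LIMSEQ_iff norm_dist_def N_nonneg)
  with l(1) show thesis by (rule that)
qed

subsection \<open>The dual space\<close>

lemma dual_add: "\<phi> \<in> dual_space V N \<Longrightarrow> f \<in> V \<Longrightarrow> g \<in> V \<Longrightarrow> \<phi> (f + g) = \<phi> f + \<phi> g"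
  and dual_scale: "\<phi> \<in> dual_space V N \<Longrightarrow> f \<in> V \<Longrightarrow> \<phi> (a *\<^sub>C f) = a * \<phi> f"
  and dual_outside: "\<phi> \<in> dual_space V N \<Longrightarrow> f \<notin> V \<Longrightarrow> \<phi> f = 0"
  unfolding dual_space_def by auto

lemma dual_zero: "\<phi> \<in> dual_space V N \<Longrightarrow> \<phi> 0 = 0"
  using dual_scale[of \<phi> 0 0] by simp

lemma dual_diff: "\<phi> \<in> dual_space V N \<Longrightarrow> f \<in> V \<Longrightarrow> g \<in> V \<Longrightarrow> \<phi> (f - g) = \<phi> f - \<phi> g"
  using dual_add[of \<phi> "f - g" g] by simp

lemma dual_bounded:
  assumes "\<phi> \<in> dual_space V N"
  obtains C where "C \<ge> 0" "\<And>f. f \<in> V \<Longrightarrow> cmod (\<phi> f) \<le> C * N f"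
proof -
  obtain C where C: "\<And>f. f \<in> V \<Longrightarrow> cmod (\<phi> f) \<le> C * N f"
    using assms unfolding dual_space_def by blast
  \<comment> \<open>A negative \<open>C\<close> can occur only on the trivial space; the absolute
    value covers that case.\<close>
  have "cmod (\<phi> f) \<le> \<bar>C\<bar> * N f" if "f \<in> V" for f
    using C[OF that] N_nonneg[OF that] by (smt (verit) mult_right_mono)
  then show thesis by (intro that[of "\<bar>C\<bar>"]) auto
qed

lemma dual_space_subspace: "complex_vector.subspace (dual_space V N)"
proof (rule complex_vector.subspaceI)
  show "0 \<in> dual_space V N"
    by (auto simp: dual_space_def intro: exI[of _ 0])
next
  fix \<phi> \<psi> assume *: "\<phi> \<in> dual_space V N" "\<psi> \<in> dual_space V N"
  obtain C D where CD: "\<And>f. f \<in> V \<Longrightarrow> cmod (\<phi> f) \<le> C * N f" "\<And>f. f \<in> V \<Longrightarrow> cmod (\<psi> f) \<le> D * N f"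
    using dual_bounded * by metis
  have "cmod (\<phi> f + \<psi> f) \<le> (C + D) * N f" if "f \<in> V" for f
    using norm_triangle_ineq[of "\<phi> f" "\<psi> f"] CD[OF that] by (simp add: distrib_right)
  with * show "\<phi> + \<psi> \<in> dual_space V N"
    by (auto simp: dual_space_def distrib_left)
next
  fix a \<phi> assume *: "\<phi> \<in> dual_space V N"
  obtain C where C: "\<And>f. f \<in> V \<Longrightarrow> cmod (\<phi> f) \<le> C * N f"
    using dual_bounded * by metis
  have "cmod (a * \<phi> f) \<le> (cmod a * C) * N f" if "f \<in> V" for f
    using mult_left_mono[OF C[OF that] norm_ge_zero[of a]] by (simp add: norm_mult mult.assoc)
  with * show "a *\<^sub>C \<phi> \<in> dual_space V N"
    unfolding dual_space_def scaleC_fun_def scaleC_complex_def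
    by (simp add: distrib_left mult.left_commute) blast
qed

lemma dual_norm_bdd:
  assumes "\<phi> \<in> dual_space V N"
  shows "bdd_above ((\<lambda>f. cmod (\<phi> f)) ` {f \<in> V. N f \<le> 1})"
proof -
  obtain C where C: "C \<ge> 0" "\<And>f. f \<in> V \<Longrightarrow> cmod (\<phi> f) \<le> C * N f"
    using dual_bounded assms by metis
  have "cmod (\<phi> f) \<le> C" if "f \<in> V" "N f \<le> 1" for f
    using C(2)[OF that(1)] mult_left_mono[OF that(2) C(1)] by simp
  then show ?thesis by (intro bdd_aboveI[of _ C]) auto
qed

lemma dual_norm_ge_ball:
  "\<phi> \<in> dual_space V N \<Longrightarrow> f \<in> V \<Longrightarrow> N f \<le> 1 \<Longrightarrow> cmod (\<phi> f) \<le> dual_norm V N \<phi>"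
  unfolding dual_norm_def by (intro cSUP_upper dual_norm_bdd) auto

lemma dual_norm_nonneg: "\<phi> \<in> dual_space V N \<Longrightarrow> 0 \<le> dual_norm V N \<phi>"
  using dual_norm_ge_ball[of \<phi> 0] order_trans[OF norm_ge_zero] by simp

lemma dual_norm_ge:
  assumes "\<phi> \<in> dual_space V N" "f \<in> V"
  shows "cmod (\<phi> f) \<le> dual_norm V N \<phi> * N f"
proof (cases "f = 0")
  case True
  then show ?thesis using dual_zero assms by simp
next
  case False
  then have p: "N f > 0" using N_pos assms by simp
  let ?g = "complex_of_real (1 / N f) *\<^sub>C f"
  have "N ?g = 1" using p assms by (simp add: N_scale norm_divide)
  then have "cmod (\<phi> ?g) \<le> dual_norm V N \<phi>" using dual_norm_ge_ball assms by simp
  then show ?thesis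
    using p dual_scale[OF assms] by (simp add: norm_mult norm_divide divide_simps)
qed

lemma dual_norm_le:
  "\<lbrakk>\<And>f. f \<in> V \<Longrightarrow> N f \<le> 1 \<Longrightarrow> cmod (\<phi> f) \<le> C\<rbrakk> \<Longrightarrow> dual_norm V N \<phi> \<le> C"
  unfolding dual_norm_def by (rule cSUP_least) (auto intro: exI[of _ 0])

text \<open>Makes every fact proved for carriers available for the dual as well, in particular the
  description of closures by \<epsilon>-balls.\<close>

lemma dual_normed: "normed_carrier (dual_space V N) (dual_norm V N)"
proof
  have add: "dual_norm V N (\<phi> + \<psi>) \<le> dual_norm V N \<phi> + dual_norm V N \<psi>"
    if "\<phi> \<in> dual_space V N" "\<psi> \<in> dual_space V N" for \<phi> \<psi>
  proof (rule dual_norm_le)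
    fix f assume "f \<in> V" "N f \<le> 1"
    then show "cmod ((\<phi> + \<psi>) f) \<le> dual_norm V N \<phi> + dual_norm V N \<psi>"
      using dual_norm_ge_ball that norm_triangle_ineq[of "\<phi> f" "\<psi> f"]
      by (smt (verit) plus_fun_apply)
  qed
  have le: "dual_norm V N (a *\<^sub>C \<phi>) \<le> cmod a * dual_norm V N \<phi>"
    if "\<phi> \<in> dual_space V N" for a \<phi>
    by (rule dual_norm_le)
      (auto simp: scaleC_fun_def scaleC_complex_def norm_mult
        intro!: mult_left_mono dual_norm_ge_ball that)
  have scale: "dual_norm V N (a *\<^sub>C \<phi>) = cmod a * dual_norm V N \<phi>"
    if "\<phi> \<in> dual_space V N" for a \<phi>
  proof (cases "a = 0")
    case True
    then have "dual_norm V N (a *\<^sub>C \<phi>) \<le> 0" using le[OF that, of a] by simp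
    moreover have "a *\<^sub>C \<phi> \<in> dual_space V N"
      using complex_vector.subspace_scale[OF dual_space_subspace that] .
    ultimately show ?thesis using dual_norm_nonneg True by force
  next
    case False
    have *: "a *\<^sub>C \<phi> \<in> dual_space V N"
      using complex_vector.subspace_scale[OF dual_space_subspace that] .
    \<comment> \<open>The reverse inequality is \<open>le\<close> for the scalar
      \<open>inverse a\<close> and the functional \<open>a *\<^sub>C \<phi>\<close>.\<close>
    have "dual_norm V N (inverse a *\<^sub>C a *\<^sub>C \<phi>) \<le> cmod (inverse a) * dual_norm V N (a *\<^sub>C \<phi>)"
      using le[OF *] .
    then have "cmod a * dual_norm V N \<phi> \<le> dual_norm V N (a *\<^sub>C \<phi>)"
      using False by (simp add: norm_inverse divide_simps norm_divide mult.commute)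
    then show ?thesis using le[OF that, of a] by simp
  qed
  have zero: "\<phi> = 0" if "\<phi> \<in> dual_space V N" "dual_norm V N \<phi> = 0" for \<phi>
  proof
    fix f show "\<phi> f = 0 f"
      using dual_norm_ge[OF that(1), of f] dual_outside[OF that(1), of f] that(2)
      by (cases "f \<in> V") auto
  qed
  have "dual_norm V N 0 = 0"
    using scale[OF complex_vector.subspace_0[OF dual_space_subspace], of 0] by simp
  with add scale zero show "normed_space_on (dual_space V N) (dual_norm V N)"
    unfolding normed_space_on_def using dual_space_subspace dual_norm_nonneg by blast
qed

text \<open>The unit ball is invariant under unimodular scalars, so an almost norming vector can be
  rotated until the value of the functional is real and nonnegative.\<close>

lemma dual_norm_nearly_attained:
  assumes "\<phi> \<in> dual_space V N" "d \<le> dual_norm V N \<phi>" "\<epsilon> > 0"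
  obtains v where "v \<in> V" "N v \<le> 1" "Re (\<phi> v) \<ge> d - \<epsilon>"
proof -
  have "\<exists>v\<in>{f \<in> V. N f \<le> 1}. d - \<epsilon> < cmod (\<phi> v)"
  proof (rule ccontr)
    assume "\<not> ?thesis"
    then have "dual_norm V N \<phi> \<le> d - \<epsilon>" by (intro dual_norm_le) (simp add: not_less)
    with assms show False by simp
  qed
  then obtain v where v: "v \<in> V" "N v \<le> 1" "d - \<epsilon> < cmod (\<phi> v)" by auto
  let ?a = "if \<phi> v = 0 then 1 else cnj (\<phi> v) / cmod (\<phi> v)"
  have "cmod ?a = 1" by (auto simp: norm_divide)
  moreover have "?a * \<phi> v = cmod (\<phi> v)"
    using complex_norm_square[of "\<phi> v"] by (auto simp: field_simps power2_eq_square)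
  ultimately show thesis
    using v by (intro that[of "?a *\<^sub>C v"]) (simp_all only: N_scale dual_scale[OF assms(1)] scale_in, auto)
qed

end

locale uniform_carrier =
  fixes V :: "'v::complex_vector set" and N :: "'v \<Rightarrow> real"
  assumes uniform: "uniform_banach_space V N"
begin

sublocale normed_carrier V N
  using uniform by unfold_locales (simp add: uniform_banach_space_def banach_space_on_def)

lemma complete: "Metric_space.mcomplete V (norm_dist V N)"
  using uniform by (simp add: uniform_banach_space_def banach_space_on_def)

subsection \<open>Uniform convexity\<close>

text \<open>If \<open>f + g\<close> has norm almost 2, then \<open>f\<close> and \<open>g\<close>
  have norm almost 1. Normalizing them moves each by at most \<epsilon>, and uniform convexity on
  the sphere applies.\<close>

lemma uniformly_convex_ball:
  assumes "\<eta> > 0"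
  obtains \<epsilon> where "\<epsilon> > 0"
    "\<And>f g. \<lbrakk>f \<in> V; g \<in> V; N f \<le> 1; N g \<le> 1; N (f + g) \<ge> 2 - \<epsilon>\<rbrakk> \<Longrightarrow> N (f - g) < \<eta>"
proof -
  obtain \<delta> where \<delta>: "\<delta> > 0"
    "\<And>f g. \<lbrakk>f \<in> V; g \<in> V; N f = 1; N g = 1; N (f - g) \<ge> \<eta> / 2\<rbrakk> \<Longrightarrow> N (f + g) \<le> 2 - \<delta>"
    using uniform assms half_gt_zero[OF assms]
    unfolding uniform_banach_space_def uniformly_convex_on_def by meson
  \<comment> \<open>The bound \<delta>/4 gives 3\<epsilon> < \<delta>, the bound \<eta>/8 gives
    \<eta>/2 + 2\<epsilon> < \<eta>, and 1/2 keeps both norms away from 0.\<close>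
  define \<epsilon> where "\<epsilon> = min (min (\<delta> / 4) (\<eta> / 8)) (1 / 2)"
  have \<epsilon>: "\<epsilon> > 0" "\<epsilon> \<le> \<delta> / 4" "\<epsilon> \<le> \<eta> / 8" "\<epsilon> \<le> 1 / 2"
    using \<delta>(1) assms by (auto simp: \<epsilon>_def)
  show thesis
  proof (rule that[OF \<epsilon>(1)])
    fix f g assume fg: "f \<in> V" "g \<in> V" "N f \<le> 1" "N g \<le> 1" "N (f + g) \<ge> 2 - \<epsilon>"
    define f' g' where "f' = complex_of_real (1 / N f) *\<^sub>C f" "g' = complex_of_real (1 / N g) *\<^sub>C g"
    have ge: "N f \<ge> 1 - \<epsilon>" "N g \<ge> 1 - \<epsilon>"
      using N_add[of f g] fg by linarith+
    then have pos: "N f > 0" "N g > 0" using \<epsilon> by linarith+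
    have in': "f' \<in> V" "g' \<in> V" "N f' = 1" "N g' = 1"
      using fg pos by (simp_all add: f'_g'_def N_scale norm_divide)
    have close: "N (h - complex_of_real (1 / N h) *\<^sub>C h) \<le> \<epsilon>"
      if "h \<in> V" "N h > 0" "N h \<ge> 1 - \<epsilon>" "N h \<le> 1" for h
    proof -
      have "h - complex_of_real (1 / N h) *\<^sub>C h = complex_of_real (1 - 1 / N h) *\<^sub>C h"
        using complex_vector.scale_left_diff_distrib[of 1 "complex_of_real (1 / N h)" h]
        by (simp add: scaleC_one)
      then have "N (h - complex_of_real (1 / N h) *\<^sub>C h) = \<bar>1 - 1 / N h\<bar> * N h"
        using that by (simp only: N_scale norm_of_real)
      also have "\<dots> = 1 - N h" using that by (simp add: abs_if field_simps)
      finally show ?thesis using that by simp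
    qed
    have c: "N (f - f') \<le> \<epsilon>" "N (g - g') \<le> \<epsilon>"
      using close fg pos ge by (simp_all add: f'_g'_def)
    have "N (f + g) \<le> N (f' + g') + N ((f + g) - (f' + g'))"
      using fg in' by (intro N_diff_le) auto
    also have "(f + g) - (f' + g') = (f - f') + (g - g')" by simp
    finally have "N (f' + g') \<ge> 2 - 3 * \<epsilon>"
      using N_add[of "f - f'" "g - g'"] fg in' c by auto
    then have "N (f' + g') > 2 - \<delta>" using \<epsilon> \<delta>(1) by linarith
    then have "N (f' - g') < \<eta> / 2" using \<delta>(2)[of f' g'] in' by linarith
    moreover have "N (f - g) \<le> N (f - f') + N (f' - g)" using fg in' N_triangle by blast
    moreover have "N (f' - g) \<le> N (f' - g') + N (g' - g)" using fg in' N_triangle by blast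
    moreover have "N (g' - g) = N (g - g')" using fg in' N_diff_commute by blast
    ultimately show "N (f - g) < \<eta>" using c \<epsilon> assms by linarith
  qed
qed

text \<open>Dividing by \<open>r + \<epsilon>\<close> reduces this to the unit ball. For
  \<open>r = 0\<close> there is nothing to rescale, but then both vectors are themselves
  small.\<close>

lemma uniformly_convex_radius:
  assumes "\<eta> > 0" "r \<ge> 0"
  obtains \<epsilon> where "\<epsilon> > 0"
    "\<And>f g. \<lbrakk>f \<in> V; g \<in> V; N f \<le> r + \<epsilon>; N g \<le> r + \<epsilon>; N (f + g) \<ge> 2 * r\<rbrakk> \<Longrightarrow> N (f - g) < \<eta>"
proof (cases "r = 0")
  case True
  have "N (f - g) < \<eta>" if "f \<in> V" "g \<in> V" "N f \<le> r + \<eta> / 3" "N g \<le> r + \<eta> / 3" for f g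
    using N_diff[OF that(1,2)] that True assms by linarith
  then show thesis using assms by (intro that[of "\<eta> / 3"]) auto
next
  case False
  then have r: "r > 0" using assms by simp
  obtain \<delta> where \<delta>: "\<delta> > 0"
    "\<And>f g. \<lbrakk>f \<in> V; g \<in> V; N f \<le> 1; N g \<le> 1; N (f + g) \<ge> 2 - \<delta>\<rbrakk> \<Longrightarrow> N (f - g) < \<eta> / (r + 1)"
    using uniformly_convex_ball[of "\<eta> / (r + 1)"] assms by (auto simp: field_simps)
  \<comment> \<open>From 2\<epsilon> \<le> r\<delta> follows 2r/(r + \<epsilon>) \<ge> 2 - \<delta>,
    and \<epsilon> \<le> 1 lets the factor r + 1 absorb r + \<epsilon> when scaling back.\<close>
  define \<epsilon> where "\<epsilon> = min 1 (r * \<delta> / 2)"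
  have \<epsilon>: "\<epsilon> > 0" "\<epsilon> \<le> 1" "2 * \<epsilon> \<le> r * \<delta>" using r \<delta> by (auto simp: \<epsilon>_def)
  show thesis
  proof (rule that[OF \<epsilon>(1)])
    fix f g assume fg: "f \<in> V" "g \<in> V" "N f \<le> r + \<epsilon>" "N g \<le> r + \<epsilon>" "N (f + g) \<ge> 2 * r"
    let ?c = "complex_of_real (1 / (r + \<epsilon>))"
    have N_c: "N (?c *\<^sub>C h) = N h / (r + \<epsilon>)" if "h \<in> V" for h
      using that r \<epsilon> by (simp only: N_scale norm_of_real) simp
    have "2 * r / (r + \<epsilon>) \<ge> 2 - \<delta>"
    proof -
      have "(2 - \<delta>) * (r + \<epsilon>) \<le> 2 * r"
        using \<epsilon> mult_pos_pos[OF \<delta>(1) \<epsilon>(1)] by (simp add: algebra_simps)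
      then show ?thesis using r \<epsilon> by (simp add: field_simps)
    qed
    also have "2 * r / (r + \<epsilon>) \<le> N (f + g) / (r + \<epsilon>)"
      using fg r \<epsilon> by (intro divide_right_mono) auto
    finally have "N (?c *\<^sub>C f + ?c *\<^sub>C g) \<ge> 2 - \<delta>"
      using N_c[of "f + g"] fg by (simp only: scaleC_add_right[symmetric] add_in)
    moreover have "N (?c *\<^sub>C f) \<le> 1" "N (?c *\<^sub>C g) \<le> 1"
      using fg r \<epsilon> by (simp_all only: N_c) simp_all
    ultimately have "N (?c *\<^sub>C f - ?c *\<^sub>C g) < \<eta> / (r + 1)"
      using \<delta>(2) fg scale_in by blast
    then have "N (f - g) / (r + \<epsilon>) < \<eta> / (r + 1)"
      using N_c[of "f - g"] fg by (simp only: complex_vector.scale_right_diff_distrib[symmetric] diff_in)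
    then have "N (f - g) < \<eta> / (r + 1) * (r + \<epsilon>)" using r \<epsilon> by (simp add: pos_divide_less_eq)
    also have "\<dots> \<le> \<eta>" using r \<epsilon> assms by (simp add: field_simps)
    finally show "N (f - g) < \<eta>" .
  qed
qed

text \<open>A minimizing sequence is Cauchy: midpoints of elements of \<open>W\<close> stay in
  \<open>W\<close>, so the sum of two almost shortest vectors of the coset has norm at least twice
  the infimum, and uniform convexity forces the two together.\<close>

lemma min_norm_in_coset:
  assumes f: "f \<in> V" and W: "complex_vector.subspace W" "W \<subseteq> V"
    and closed: "\<And>u l. \<lbrakk>\<And>n::nat. u n \<in> W; l \<in> V; (\<lambda>n. N (u n - l)) \<longlonglongrightarrow> 0\<rbrakk> \<Longrightarrow> l \<in> W"
  obtains f\<^sub>0 where "f\<^sub>0 \<in> V" "f - f\<^sub>0 \<in> W" "\<And>g. g \<in> W \<Longrightarrow> N f\<^sub>0 \<le> N (f\<^sub>0 + g)"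
proof -
  define r where "r = (INF w\<in>W. N (f - w))"
  have r_le: "r \<le> N (f - w)" if "w \<in> W" for w
    unfolding r_def using that f W(2) by (intro cINF_lower bdd_belowI[of _ 0]) (auto intro!: N_nonneg)
  have W0: "0 \<in> W" using W(1) by (rule complex_vector.subspace_0)
  then have r0: "r \<ge> 0"
    unfolding r_def using f W(2) by (intro cINF_greatest) (auto intro!: N_nonneg)
  have "\<exists>w\<in>W. N (f - w) < r + \<epsilon>" if "\<epsilon> > 0" for \<epsilon>
  proof (rule ccontr)
    assume "\<not> ?thesis"
    then have "r + \<epsilon> \<le> r" unfolding r_def using W0 by (intro cINF_greatest) (auto simp: not_less)
    then show False using that by simp
  qed
  then have "\<forall>n. \<exists>w\<in>W. N (f - w) < r + 1 / Suc n" by simp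
  then obtain w where w: "\<And>n. w n \<in> W" "\<And>n. N (f - w n) < r + 1 / Suc n" by metis
  have wV: "w n \<in> V" for n using w W by auto
  have "\<exists>M. \<forall>m\<ge>M. \<forall>n\<ge>M. N (w m - w n) < \<eta>" if \<eta>: "\<eta> > 0" for \<eta>
  proof -
    obtain \<epsilon> where \<epsilon>: "\<epsilon> > 0"
      "\<And>f g. \<lbrakk>f \<in> V; g \<in> V; N f \<le> r + \<epsilon>; N g \<le> r + \<epsilon>; N (f + g) \<ge> 2 * r\<rbrakk> \<Longrightarrow> N (f - g) < \<eta>"
      using uniformly_convex_radius[OF \<eta> r0] by metis
    obtain M where M: "1 / Suc M < \<epsilon>" using \<epsilon>(1) nat_approx_posE by blast
    have "N (w m - w n) < \<eta>" if "m \<ge> M" "n \<ge> M" for m n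
    proof -
      let ?h = "complex_of_real (1/2) *\<^sub>C (w m + w n)"
      have le: "N (f - w k) \<le> r + \<epsilon>" if "k \<ge> M" for k
        using w(2)[of k] M frac_le[of 1 1 "Suc M" "Suc k"] that by simp
      have "?h \<in> W"
        using w(1) W(1) by (blast intro: complex_vector.subspace_add complex_vector.subspace_scale)
      then have "r \<le> N (f - ?h)" by (rule r_le)
      moreover have "(f - w n) + (f - w m) = 2 *\<^sub>C (f - ?h)"
        using scaleC_add_left[of 1 1 f]
        by (simp add: complex_vector.scale_right_diff_distrib scaleC_scaleC scaleC_one)
      ultimately have "N ((f - w n) + (f - w m)) \<ge> 2 * r"
        using N_scale[of "f - ?h" 2] f wV by simp
      then have "N ((f - w n) - (f - w m)) < \<eta>"
        using \<epsilon>(2)[OF _ _ le[OF that(2)] le[OF that(1)]] f wV by simp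
      then show ?thesis by simp
    qed
    then show ?thesis by blast
  qed
  from complete_limit[OF complete wV this]
  obtain l where l: "l \<in> V" "(\<lambda>n. N (w n - l)) \<longlonglongrightarrow> 0" by blast
  have lW: "l \<in> W" by (rule closed[OF w(1) l])
  have "N (f - l) \<le> r"
  proof (rule LIMSEQ_le_const)
    have "(\<lambda>n. r + 1 / Suc n + N (w n - l)) \<longlonglongrightarrow> r + 0 + 0"
      using LIMSEQ_inverse_real_of_nat l(2) by (intro tendsto_add tendsto_const) (simp_all add: inverse_eq_divide)
    then show "(\<lambda>n. r + 1 / Suc n + N (w n - l)) \<longlonglongrightarrow> r" by simp
    show "\<exists>M. \<forall>n\<ge>M. N (f - l) \<le> r + 1 / Suc n + N (w n - l)"
      using w(2) N_triangle[OF f wV l(1)] by (meson add_right_mono less_imp_le order_trans)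
  qed
  moreover have "r \<le> N (f - l + g)" if "g \<in> W" for g
    using r_le[of "l - g"] complex_vector.subspace_diff[OF W(1) lW that]
    by (simp add: algebra_simps)
  ultimately have "N (f - l) \<le> N (f - l + g)" if "g \<in> W" for g
    using that by fastforce
  then show thesis using f l(1) lW by (intro that[of "f - l"]) auto
qed

subsection \<open>Separation by elements of the space\<close>

lemma separate_from_dual_subspace:
  assumes \<phi>: "\<phi> \<in> dual_space V N"
    and M: "complex_vector.subspace M" "M \<subseteq> dual_space V N"
    and d: "d > 0" "\<And>\<mu>. \<mu> \<in> M \<Longrightarrow> d \<le> dual_norm V N (\<phi> - \<mu>)"
  obtains u where "u \<in> V" "\<And>\<mu>. \<mu> \<in> M \<Longrightarrow> \<mu> u = 0" "\<phi> u \<noteq> 0"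
proof -
  interpret D: normed_carrier "dual_space V N" "dual_norm V N" by (rule dual_normed)
  let ?n = "dual_norm V N"
  \<comment> \<open>The given bound \<open>d\<close> only ensures that the exact distance
    \<open>e\<close> of \<phi> from \<open>M\<close> is positive; the construction works with
    \<open>e\<close>.\<close>
  define e where "e = (INF \<mu>\<in>M. ?n (\<phi> - \<mu>))"
  have MD: "\<mu> \<in> dual_space V N" if "\<mu> \<in> M" for \<mu> using that M by auto
  have e_le: "e \<le> ?n (\<phi> - \<mu>)" if "\<mu> \<in> M" for \<mu>
    unfolding e_def using that \<phi> MD by (intro cINF_lower bdd_belowI[of _ 0]) (auto intro!: D.N_nonneg)
  have M0: "0 \<in> M" using M(1) by (rule complex_vector.subspace_0)
  have "d \<le> e" unfolding e_def using M0 d(2) by (intro cINF_greatest) auto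
  with d(1) have e: "e > 0" by simp
  have near: "\<exists>\<mu>\<in>M. ?n (\<phi> - \<mu>) \<le> e + \<epsilon>" if "\<epsilon> > 0" for \<epsilon>
  proof (rule ccontr)
    assume "\<not> ?thesis"
    then have "e + \<epsilon> \<le> e" unfolding e_def using M0 by (intro cINF_greatest) (auto simp: not_le)
    then show False using that by simp
  qed
  \<comment> \<open>\<open>P\<close> measures near optimality in both respects at once: \<mu> almost
    realizes the distance, and \<open>v\<close> almost norms the difference \<phi> - \<mu>.\<close>
  define P where "P \<epsilon> \<mu> v \<longleftrightarrow> \<mu> \<in> M \<and> ?n (\<phi> - \<mu>) \<le> e + \<epsilon> \<and> v \<in> V \<and> N v \<le> 1 \<and>
    e - \<epsilon> \<le> Re (\<phi> v - \<mu> v)" for \<epsilon> \<mu> v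
  have P_mono: "P \<epsilon>' \<mu> v" if "P \<epsilon> \<mu> v" "\<epsilon> \<le> \<epsilon>'" for \<epsilon> \<epsilon>' \<mu> v
    using that unfolding P_def by linarith
  have attain: "\<exists>v\<in>V. N v \<le> 1 \<and> e - \<epsilon> \<le> Re (\<phi> v - \<mu> v)" if "\<mu> \<in> M" "\<epsilon> > 0" for \<epsilon> \<mu>
    using dual_norm_nearly_attained[OF D.diff_in[OF \<phi> MD[OF that(1)]] e_le[OF that(1)] that(2)]
    by (metis minus_apply)
  have upper: "Re (\<phi> v - \<mu> v) \<le> ?n (\<phi> - \<mu>) * N v" if "\<mu> \<in> M" "v \<in> V" for \<mu> v
    using dual_norm_ge[OF D.diff_in[OF \<phi> MD[OF that(1)]] that(2)] complex_Re_le_cmod[of "\<phi> v - \<mu> v"]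
    by simp
  have ball: "Re (\<phi> v - \<mu> v) \<le> ?n (\<phi> - \<mu>)" if "\<mu> \<in> M" "v \<in> V" "N v \<le> 1" for \<mu> v
    using dual_norm_ge_ball[OF D.diff_in[OF \<phi> MD[OF that(1)]] that(2,3)] complex_Re_le_cmod[of "\<phi> v - \<mu> v"]
    by simp
  \<comment> \<open>First with a common \<mu>: on \<open>v + w\<close> the functional \<phi> - \<mu>
    is nearly 2e while its norm is nearly e, so \<open>v + w\<close> has norm nearly 2.\<close>
  have same: "\<exists>\<epsilon>>0. \<forall>\<mu> v w. P \<epsilon> \<mu> v \<longrightarrow> P \<epsilon> \<mu> w \<longrightarrow> N (v - w) < \<eta>" if \<eta>: "\<eta> > 0" for \<eta>
  proof -
    obtain \<delta> where \<delta>: "\<delta> > 0"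
      "\<And>f g. \<lbrakk>f \<in> V; g \<in> V; N f \<le> 1; N g \<le> 1; N (f + g) \<ge> 2 - \<delta>\<rbrakk> \<Longrightarrow> N (f - g) < \<eta>"
      using uniformly_convex_ball[OF \<eta>] by metis
    \<comment> \<open>Chosen so that (2 - \<delta>)(e + \<epsilon>) \<le> 2e - 2\<epsilon>.\<close>
    define \<epsilon> where "\<epsilon> = e * \<delta> / 4"
    have \<epsilon>: "\<epsilon> > 0" using e \<delta> by (simp add: \<epsilon>_def)
    have "N (v - w) < \<eta>" if "P \<epsilon> \<mu> v" "P \<epsilon> \<mu> w" for \<mu> v w
    proof (rule \<delta>(2))
      have *: "\<mu> \<in> M" "v \<in> V" "w \<in> V" "?n (\<phi> - \<mu>) \<le> e + \<epsilon>" using that unfolding P_def by auto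
      have "2 * e - 2 * \<epsilon> \<le> Re (\<phi> (v + w) - \<mu> (v + w))"
        using that unfolding P_def by (simp add: dual_add[OF \<phi>] dual_add[OF MD])
      also have "\<dots> \<le> ?n (\<phi> - \<mu>) * N (v + w)" using * by (intro upper) auto
      also have "\<dots> \<le> (e + \<epsilon>) * N (v + w)" using * by (intro mult_right_mono N_nonneg) auto
      finally have 1: "2 * e - 2 * \<epsilon> \<le> (e + \<epsilon>) * N (v + w)" .
      have "(2 - \<delta>) * (e + \<epsilon>) \<le> 2 * e - 2 * \<epsilon>"
        using e \<delta>(1) mult_pos_pos[OF \<delta>(1) \<epsilon>] by (simp add: \<epsilon>_def algebra_simps)
      with 1 have "(2 - \<delta>) * (e + \<epsilon>) \<le> N (v + w) * (e + \<epsilon>)" by (simp add: mult.commute)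
      then show "2 - \<delta> \<le> N (v + w)" using e \<epsilon> by simp
    qed (use that in \<open>auto simp: P_def\<close>)
    with \<epsilon> show ?thesis by blast
  qed
  text \<open>A vector almost norming the midpoint functional almost norms both functionals.\<close>
  have diff: "\<exists>\<epsilon>>0. \<forall>\<mu> \<nu> v w. P \<epsilon> \<mu> v \<longrightarrow> P \<epsilon> \<nu> w \<longrightarrow> N (v - w) < \<eta>" if \<eta>: "\<eta> > 0" for \<eta>
  proof -
    obtain \<epsilon> where \<epsilon>: "\<epsilon> > 0" "\<And>\<mu> v w. P \<epsilon> \<mu> v \<Longrightarrow> P \<epsilon> \<mu> w \<Longrightarrow> N (v - w) < \<eta> / 2"
      using same[of "\<eta> / 2"] \<eta> by auto
    have "N (v - w) < \<eta>" if P: "P (\<epsilon> / 3) \<mu> v" "P (\<epsilon> / 3) \<nu> w" for \<mu> \<nu> v w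
    proof -
      have *: "\<mu> \<in> M" "\<nu> \<in> M" "v \<in> V" "w \<in> V" using P unfolding P_def by auto
      let ?\<kappa> = "complex_of_real (1/2) *\<^sub>C (\<mu> + \<nu>)"
      have "?\<kappa> \<in> M"
        using * M(1) by (blast intro: complex_vector.subspace_add complex_vector.subspace_scale)
      then obtain z where z: "z \<in> V" "N z \<le> 1" "e - \<epsilon> / 3 \<le> Re (\<phi> z - ?\<kappa> z)"
        using attain[of ?\<kappa> "\<epsilon> / 3"] \<epsilon>(1) by auto
      have "Re (?\<kappa> z) = (Re (\<mu> z) + Re (\<nu> z)) / 2" by (simp add: scaleC_fun_def scaleC_complex_def)
      then have "2 * (e - \<epsilon> / 3) \<le> Re (\<phi> z - \<mu> z) + Re (\<phi> z - \<nu> z)" using z(3) by simp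
      \<comment> \<open>The two real parts add up to at least 2e - 2\<epsilon>/3 and each is at most
        e + \<epsilon>/3, so each is at least e - \<epsilon>.\<close>
      then have "P \<epsilon> \<mu> z" "P \<epsilon> \<nu> z"
        using P z ball[OF *(1) z(1,2)] ball[OF *(2) z(1,2)] \<epsilon>(1) unfolding P_def by auto
      moreover have "P \<epsilon> \<mu> v" "P \<epsilon> \<nu> w" using P \<epsilon>(1) by (auto intro: P_mono)
      ultimately have "N (v - z) < \<eta> / 2" "N (z - w) < \<eta> / 2" using \<epsilon>(2) by blast+
      then show ?thesis using N_triangle[OF *(3) z(1) *(4)] by simp
    qed
    then show ?thesis using \<epsilon>(1) by (intro exI[of _ "\<epsilon> / 3"]) auto
  qed
  have "\<exists>\<mu> v. P \<epsilon> \<mu> v" if "\<epsilon> > 0" for \<epsilon>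
    using near[OF that] attain[OF _ that] unfolding P_def by meson
  then have "\<exists>\<mu> v. P (1 / Suc n) \<mu> v" for n by simp
  then obtain \<mu> u where P: "\<And>n. P (1 / Suc n) (\<mu> n) (u n)" by metis
  have uV: "u n \<in> V" for n using P unfolding P_def by blast
  have P_late: "\<exists>K. \<forall>n\<ge>K. P \<epsilon> (\<mu> n) (u n)" if \<epsilon>: "\<epsilon> > 0" for \<epsilon>
  proof -
    obtain K where "1 / Suc K < \<epsilon>" using nat_approx_posE[OF \<epsilon>] .
    then have "1 / Suc n \<le> \<epsilon>" if "n \<ge> K" for n using frac_le[of 1 1 "Suc K" "Suc n"] that by simp
    then show ?thesis using P_mono[OF P] by blast
  qed
  have "\<exists>K. \<forall>m\<ge>K. \<forall>n\<ge>K. N (u m - u n) < \<eta>" if "\<eta> > 0" for \<eta>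
    using diff[OF that] P_late by meson
  from complete_limit[OF complete uV this]
  obtain l where l: "l \<in> V" "(\<lambda>n. N (u n - l)) \<longlonglongrightarrow> 0" by blast
  \<comment> \<open>Every nearly optimal pair has its vector near \<open>l\<close>, not just the
    pairs of the chosen sequence. The arguments below can therefore pick their own
    functionals.\<close>
  have close: "\<exists>\<epsilon>>0. \<forall>\<nu> w. P \<epsilon> \<nu> w \<longrightarrow> N (w - l) < \<eta>" if \<eta>: "\<eta> > 0" for \<eta>
  proof -
    obtain \<epsilon> where \<epsilon>: "\<epsilon> > 0" "\<And>\<mu> \<nu> v w. P \<epsilon> \<mu> v \<Longrightarrow> P \<epsilon> \<nu> w \<Longrightarrow> N (v - w) < \<eta> / 2"
      using diff[OF half_gt_zero[OF \<eta>]] by blast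
    obtain K1 where K1: "\<And>n. n \<ge> K1 \<Longrightarrow> P \<epsilon> (\<mu> n) (u n)" using P_late \<epsilon>(1) by blast
    obtain K2 where K2: "\<And>n. n \<ge> K2 \<Longrightarrow> N (u n - l) < \<eta> / 2"
      using order_tendstoD(2)[OF l(2), of "\<eta> / 2"] \<eta> by (auto simp: eventually_sequentially)
    let ?n = "max K1 K2"
    have "N (w - l) < \<eta>" if "P \<epsilon> \<nu> w" for \<nu> w
    proof -
      have "N (w - u ?n) < \<eta> / 2" using that K1[of ?n] \<epsilon>(2) by auto
      moreover have "N (u ?n - l) < \<eta> / 2" using K2 by auto
      moreover have "w \<in> V" using that unfolding P_def by blast
      ultimately show ?thesis using N_triangle[of w "u ?n" l] uV l(1) by fastforce
    qed
    with \<epsilon>(1) show ?thesis by blast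
  qed
  text \<open>Perturbing a nearly optimal \<open>\<mu>\<close> to \<open>\<mu> + \<delta> \<nu>\<close> moves the norming vectors only slightly,
    so a vector with \<open>Re (\<nu> l) > 0\<close> would bring the distance below its infimum.\<close>
  have Re_le: "Re (\<nu> l) \<le> 0" if \<nu>: "\<nu> \<in> M" for \<nu>
  proof (rule field_le_epsilon)
    fix \<theta> :: real assume \<theta>: "\<theta> > 0"
    define C where "C = ?n \<nu>"
    have C: "C \<ge> 0" using D.N_nonneg MD \<nu> by (simp add: C_def)
    define \<eta> where "\<eta> = \<theta> / (2 + C)"
    have \<eta>: "\<eta> > 0" using \<theta> C by (simp add: \<eta>_def)
    obtain \<epsilon> where \<epsilon>: "\<epsilon> > 0" "\<And>\<nu> w. P \<epsilon> \<nu> w \<Longrightarrow> N (w - l) < \<eta>" using close[OF \<eta>] by blast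
    \<comment> \<open>The bounds 1 and \<epsilon>/(1 + C) give \<delta>\<delta> + \<delta>C \<le>
      \<epsilon>, which keeps the perturbed vector nearly optimal for the unperturbed functional;
      \<delta> \<le> \<eta> serves the final estimate.\<close>
    define \<delta> where "\<delta> = min (min 1 \<eta>) (\<epsilon> / (1 + C))"
    have \<delta>: "\<delta> > 0" "\<delta> \<le> 1" "\<delta> \<le> \<eta>" "\<delta> \<le> \<epsilon> / (1 + C)" using \<eta> \<epsilon> C by (auto simp: \<delta>_def)
    have \<delta>\<epsilon>: "\<delta> * \<delta> + \<delta> * C \<le> \<epsilon>"
    proof -
      have "\<delta> * \<delta> + \<delta> * C \<le> \<delta> * (1 + C)"
        using mult_left_mono[OF \<delta>(2), of \<delta>] \<delta>(1) by (simp add: algebra_simps)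
      also have "\<dots> \<le> \<epsilon>" using \<delta>(4) C by (simp add: pos_le_divide_eq)
      finally show ?thesis .
    qed
    \<comment> \<open>The perturbation has size \<delta>, but optimality is required up to
      \<delta>\<delta>. The resulting bound on \<delta> Re (\<nu> v) is then 2\<delta>\<delta>,
      still small after division by \<delta>.\<close>
    obtain \<kappa> where \<kappa>: "\<kappa> \<in> M" "?n (\<phi> - \<kappa>) \<le> e + \<delta> * \<delta>" using near[of "\<delta> * \<delta>"] \<delta>(1) by auto
    let ?\<kappa>' = "\<kappa> + complex_of_real \<delta> *\<^sub>C \<nu>"
    have "?\<kappa>' \<in> M"
      using \<kappa>(1) \<nu> M(1) by (blast intro: complex_vector.subspace_add complex_vector.subspace_scale)
    then obtain v where v: "v \<in> V" "N v \<le> 1" "e - \<delta> * \<delta> \<le> Re (\<phi> v - ?\<kappa>' v)"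
      using attain[of ?\<kappa>' "\<delta> * \<delta>"] \<delta>(1) by auto
    have v': "e - \<delta> * \<delta> \<le> Re (\<phi> v - \<kappa> v) - \<delta> * Re (\<nu> v)"
      using v(3) by (simp add: scaleC_fun_def scaleC_complex_def algebra_simps)
    have "\<bar>Re (\<nu> v)\<bar> \<le> C"
      using dual_norm_ge_ball[OF MD[OF \<nu>] v(1,2)] abs_Re_le_cmod[of "\<nu> v"] by (simp add: C_def)
    then have "- \<delta> * Re (\<nu> v) \<le> \<delta> * C"
      using mult_left_mono[of "- Re (\<nu> v)" C \<delta>] \<delta>(1) by simp
    then have "e - (\<delta> * \<delta> + \<delta> * C) \<le> Re (\<phi> v - \<kappa> v)" using v' by linarith
    then have "P \<epsilon> \<kappa> v" using \<kappa> v \<delta>\<epsilon> mult_nonneg_nonneg[of \<delta> C] \<delta>(1) C unfolding P_def by linarith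
    then have vl: "N (l - v) < \<eta>" using \<epsilon>(2) N_diff_commute[OF l(1) v(1)] by force
    have "\<delta> * Re (\<nu> v) \<le> \<delta> * (2 * \<delta>)" using v' ball[OF \<kappa>(1) v(1,2)] \<kappa>(2) by simp
    then have 1: "Re (\<nu> v) \<le> 2 * \<delta>" using \<delta>(1) by simp
    have "Re (\<nu> l) = Re (\<nu> v) + Re (\<nu> (l - v))" using dual_diff[OF MD[OF \<nu>] l(1) v(1)] by simp
    also have "Re (\<nu> (l - v)) \<le> C * N (l - v)"
      using dual_norm_ge[OF MD[OF \<nu>], of "l - v"] complex_Re_le_cmod[of "\<nu> (l - v)"] l v
      by (simp add: C_def)
    also have "\<dots> \<le> C * \<eta>" using vl C by (intro mult_left_mono) auto
    also have "Re (\<nu> v) + C * \<eta> \<le> (2 + C) * \<eta>" using 1 \<delta>(3) by (simp add: algebra_simps)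
    also have "\<dots> = 0 + \<theta>" using C by (simp add: \<eta>_def)
    finally show "Re (\<nu> l) \<le> 0 + \<theta>" by simp
  qed
  have zero: "\<nu> l = 0" if \<nu>: "\<nu> \<in> M" for \<nu>
  proof -
    \<comment> \<open>This multiple of \<nu> takes at \<open>l\<close> the value of the squared
      modulus of \<nu> l.\<close>
    have "Re ((cnj (\<nu> l) *\<^sub>C \<nu>) l) \<le> 0"
      using complex_vector.subspace_scale[OF M(1) \<nu>] by (rule Re_le)
    then have "(Re (\<nu> l))\<^sup>2 + (Im (\<nu> l))\<^sup>2 \<le> 0"
      by (simp add: scaleC_fun_def scaleC_complex_def power2_eq_square)
    then show ?thesis by (simp add: sum_power2_le_zero_iff complex_eq_iff)
  qed
  have "\<phi> l \<noteq> 0"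
  proof -
    \<comment> \<open>The dual norm of \<phi> - \<nu> will be at most e + 1, so moving from
      \<open>v\<close> to \<open>l\<close> costs at most e/4. With \<epsilon> \<le> e/4 the value of
      \<phi> at \<open>l\<close> keeps real part at least e/2.\<close>
    define \<eta> where "\<eta> = e / 4 / (e + 1)"
    have \<eta>: "\<eta> > 0" using e by (simp add: \<eta>_def)
    obtain \<epsilon>' where \<epsilon>': "\<epsilon>' > 0" "\<And>\<nu> w. P \<epsilon>' \<nu> w \<Longrightarrow> N (w - l) < \<eta>" using close[OF \<eta>] by blast
    define \<epsilon> where "\<epsilon> = min (min \<epsilon>' (e / 4)) 1"
    have \<epsilon>: "\<epsilon> > 0" "\<epsilon> \<le> \<epsilon>'" "\<epsilon> \<le> e / 4" "\<epsilon> \<le> 1" using \<epsilon>'(1) e by (auto simp: \<epsilon>_def)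
    obtain \<nu> v where v: "P \<epsilon> \<nu> v" using P_late[OF \<epsilon>(1)] by blast
    then have *: "\<nu> \<in> M" "?n (\<phi> - \<nu>) \<le> e + 1" "v \<in> V" using \<epsilon> unfolding P_def by auto
    have "Re (\<phi> (v - l) - \<nu> (v - l)) \<le> ?n (\<phi> - \<nu>) * N (v - l)" using * l by (intro upper) auto
    also have "\<dots> \<le> (e + 1) * \<eta>"
      using * \<epsilon>'(2)[OF P_mono[OF v \<epsilon>(2)]] e l(1) by (intro mult_mono) (auto intro: N_nonneg)
    also have "\<dots> = e / 4"
      unfolding \<eta>_def times_divide_eq_right[of "e + 1" "e / 4"]
      using e by (intro nonzero_mult_div_cancel_left) simp
    finally have "Re (\<phi> v - \<nu> v) - Re (\<phi> l) \<le> e / 4"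
      using zero[OF *(1)] by (simp add: dual_diff[OF \<phi> *(3) l(1)] dual_diff[OF MD[OF *(1)] *(3) l(1)])
    moreover have "e - e / 4 \<le> Re (\<phi> v - \<nu> v)" using v \<epsilon> unfolding P_def by linarith
    ultimately have "Re (\<phi> l) > 0" using e by linarith
    then show ?thesis by auto
  qed
  with l(1) zero show thesis by (rule that)
qed

text \<open>If a ball of radius \<open>d\<close> around \<phi> missed the span, the separating
  vector would be killed by all of \<open>S\<close> but not by \<phi>.\<close>

lemma in_dual_closed_span:
  assumes \<phi>: "\<phi> \<in> dual_space V N" and S: "S \<subseteq> dual_space V N"
    and ann: "\<And>u. \<lbrakk>u \<in> V; \<And>\<mu>. \<mu> \<in> S \<Longrightarrow> \<mu> u = 0\<rbrakk> \<Longrightarrow> \<phi> u = 0"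
  shows "\<phi> \<in> dual_closed_span V N S"
proof -
  interpret D: normed_carrier "dual_space V N" "dual_norm V N" by (rule dual_normed)
  have span: "complex_vector.span S \<subseteq> dual_space V N"
    by (rule complex_vector.span_minimal[OF S dual_space_subspace])
  show ?thesis
    unfolding dual_closed_span_def
  proof (rule D.closure_of_norm_topologyI[OF \<phi>], rule ccontr)
    fix d :: real
    assume "d > 0" "\<not> (\<exists>\<mu>\<in>complex_vector.span S. \<mu> \<in> dual_space V N \<and> dual_norm V N (\<phi> - \<mu>) < d)"
    then obtain u where u: "u \<in> V" "\<And>\<mu>. \<mu> \<in> complex_vector.span S \<Longrightarrow> \<mu> u = 0" "\<phi> u \<noteq> 0"
      using separate_from_dual_subspace[OF \<phi> complex_vector.subspace_span[of S] span, of d] span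
      by (force simp: not_less)
    then show False using ann[of u] complex_vector.span_base by blast
  qed
qed

subsection \<open>The compatible semi-inner product\<close>

text \<open>For \<open>f \<noteq> 0\<close> this turns out to be the real part of
  \<open>[g,f]\<close> divided by \<open>N f\<close>, which ties the semi-inner product to the
  norm.\<close>

definition gateaux :: "'v \<Rightarrow> 'v \<Rightarrow> real" where
  "gateaux f g = deriv (\<lambda>t. N (f + complex_of_real t *\<^sub>C g)) 0"

text \<open>Differentiability is given for unit vectors. Pulling out the factor \<open>N f\<close>
  and substituting \<open>?c * t\<close> for \<open>t\<close> reduces the general case to it by the
  chain rule.\<close>

lemma norm_differentiable:
  assumes f: "f \<in> V" "f \<noteq> 0" and g: "g \<in> V"
  shows "\<exists>D. ((\<lambda>t. N (f + complex_of_real t *\<^sub>C g)) has_real_derivative D) (at 0)"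
proof (cases "g = 0")
  case True
  then show ?thesis by (auto intro: exI[of _ 0])
next
  case False
  have pos: "N f > 0" "N g > 0" using N_pos f g False by auto
  let ?f = "complex_of_real (1 / N f) *\<^sub>C f" and ?g = "complex_of_real (1 / N g) *\<^sub>C g"
  let ?c = "N g / N f"
  have unit: "?f \<in> V" "?g \<in> V" "N ?f = 1" "N ?g = 1"
    using f g pos by (simp_all add: N_scale norm_divide)
  obtain L where "uniform_limit ({f \<in> V. N f = 1} \<times> {f \<in> V. N f = 1})
      (\<lambda>t (f, g). (N (f + complex_of_real t *\<^sub>C g) - N f) / t) L (at (0::real))"
    using uniform
    unfolding uniform_banach_space_def uniformly_frechet_differentiable_on_def Let_def by blast
  from tendsto_uniform_limitI[OF this, of "(?f, ?g)"] unit
  have "((\<lambda>t. N (?f + complex_of_real t *\<^sub>C ?g)) has_real_derivative L (?f, ?g)) (at (?c * 0))"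
    by (simp add: DERIV_def)
  from DERIV_chain2[where f="\<lambda>t. N (?f + complex_of_real t *\<^sub>C ?g)" and g="\<lambda>t. ?c * t", OF this DERIV_cmult_Id]
  have "((\<lambda>t. N f * N (?f + complex_of_real (?c * t) *\<^sub>C ?g)) has_real_derivative N f * (L (?f, ?g) * ?c)) (at 0)"
    by (rule DERIV_cmult)
  moreover have "N f * N (?f + complex_of_real (?c * t) *\<^sub>C ?g) = N (f + complex_of_real t *\<^sub>C g)" for t
  proof -
    have "complex_of_real (N f) *\<^sub>C (?f + complex_of_real (?c * t) *\<^sub>C ?g) = f + complex_of_real t *\<^sub>C g"
      using pos by (simp add: scaleC_add_right scaleC_scaleC scaleC_one)
    moreover have "N (complex_of_real (N f) *\<^sub>C (?f + complex_of_real (?c * t) *\<^sub>C ?g)) =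
        N f * N (?f + complex_of_real (?c * t) *\<^sub>C ?g)"
      using f g pos by (subst N_scale) auto
    ultimately show ?thesis by (simp only:)
  qed
  ultimately show ?thesis by auto
qed

lemma gateaux_DERIV:
  assumes "f \<in> V" "f \<noteq> 0" "g \<in> V"
  shows "((\<lambda>t. N (f + complex_of_real t *\<^sub>C g)) has_real_derivative gateaux f g) (at 0)"
  using norm_differentiable[OF assms] DERIV_imp_deriv unfolding gateaux_def by blast

lemma gateaux_eqI:
  "((\<lambda>t. N (f + complex_of_real t *\<^sub>C g)) has_real_derivative D) (at 0) \<Longrightarrow> gateaux f g = D"
  unfolding gateaux_def by (rule DERIV_imp_deriv)

lemma gateaux_DERIV_scaled:
  assumes "f \<in> V" "f \<noteq> 0" "g \<in> V"
  shows "((\<lambda>t. N (f + complex_of_real (r * t) *\<^sub>C g)) has_real_derivative r * gateaux f g) (at 0)"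
proof -
  have "((\<lambda>t. N (f + complex_of_real t *\<^sub>C g)) has_real_derivative gateaux f g) (at (r * 0))"
    using gateaux_DERIV[OF assms] by simp
  from DERIV_chain2[where f="\<lambda>t. N (f + complex_of_real t *\<^sub>C g)" and g="\<lambda>t. r * t", OF this DERIV_cmult_Id]
  show ?thesis by (simp only: mult.commute)
qed

lemma gateaux_scaleR:
  assumes "f \<in> V" "f \<noteq> 0" "g \<in> V"
  shows "gateaux f (complex_of_real r *\<^sub>C g) = r * gateaux f g"
  using gateaux_DERIV_scaled[OF assms, of r]
  by (intro gateaux_eqI) (simp add: scaleC_scaleC mult.commute)

text \<open>By convexity of the norm, \<open>?F\<close> below is nonnegative and vanishes at 0.
  Being differentiable, it has derivative 0 there, and this derivative is the defect of
  additivity.\<close>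

lemma gateaux_add:
  assumes f: "f \<in> V" "f \<noteq> 0" and "g \<in> V" "h \<in> V"
  shows "gateaux f (g + h) = gateaux f g + gateaux f h"
proof -
  let ?F = "\<lambda>t. (N (f + complex_of_real (2 * t) *\<^sub>C g) + N (f + complex_of_real (2 * t) *\<^sub>C h)) / 2
      - N (f + complex_of_real t *\<^sub>C (g + h))"
  have deriv: "(?F has_real_derivative (2 * gateaux f g + 2 * gateaux f h) / 2 - gateaux f (g + h)) (at 0)"
    using assms by (intro DERIV_diff DERIV_cdivide DERIV_add gateaux_DERIV gateaux_DERIV_scaled) auto
  have min: "?F 0 \<le> ?F t" for t
  proof -
    let ?x = "f + complex_of_real (2 * t) *\<^sub>C g" and ?y = "f + complex_of_real (2 * t) *\<^sub>C h"
    have "?x + ?y = 2 *\<^sub>C (f + complex_of_real t *\<^sub>C (g + h))"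
      using scaleC_add_left[of 1 1 f] by (simp add: scaleC_add_right scaleC_scaleC scaleC_one)
    then have "2 * N (f + complex_of_real t *\<^sub>C (g + h)) = N (?x + ?y)"
      using N_scale[of "f + complex_of_real t *\<^sub>C (g + h)" 2] assms by simp
    also have "\<dots> \<le> N ?x + N ?y" using assms by (intro N_add) auto
    finally show ?thesis by simp
  qed
  have "(2 * gateaux f g + 2 * gateaux f h) / 2 - gateaux f (g + h) = 0"
    by (rule DERIV_local_min[OF deriv, of 1]) (use min in auto)
  then show ?thesis by simp
qed

lemma gateaux_scale:
  assumes f: "f \<in> V" "f \<noteq> 0" and g: "g \<in> V"
  shows "gateaux f (a *\<^sub>C g) = Re a * gateaux f g + Im a * gateaux f (\<i> *\<^sub>C g)"
proof -
  have "a *\<^sub>C g = complex_of_real (Re a) *\<^sub>C g + complex_of_real (Im a) *\<^sub>C \<i> *\<^sub>C g"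
    using complex_eq[of a] by (simp add: scaleC_scaleC scaleC_add_left[symmetric] mult.commute)
  also have "gateaux f \<dots> =
      gateaux f (complex_of_real (Re a) *\<^sub>C g) + gateaux f (complex_of_real (Im a) *\<^sub>C \<i> *\<^sub>C g)"
    using assms by (intro gateaux_add) auto
  also have "\<dots> = Re a * gateaux f g + Im a * gateaux f (\<i> *\<^sub>C g)"
    using assms by (intro arg_cong2[where f="(+)"] gateaux_scaleR) auto
  finally show ?thesis .
qed

lemma gateaux_self:
  assumes f: "f \<in> V" "f \<noteq> 0"
  shows "gateaux f f = N f"
proof (rule gateaux_eqI)
  have eq: "N (f + complex_of_real t *\<^sub>C f) = \<bar>1 + t\<bar> * N f" for t
  proof -
    have "f + complex_of_real t *\<^sub>C f = complex_of_real (1 + t) *\<^sub>C f"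
      using scaleC_add_left[of 1 "complex_of_real t" f] by (simp add: scaleC_one)
    then show ?thesis using N_scale[OF f(1)] by (simp only: norm_of_real)
  qed
  have "((\<lambda>t. (1 + t) * N f) has_real_derivative N f) (at 0)"
    by (auto intro!: derivative_eq_intros)
  then show "((\<lambda>t. N (f + complex_of_real t *\<^sub>C f)) has_real_derivative N f) (at 0)"
    \<comment> \<open>For |t| < 1 the factor |1 + t| is 1 + t.\<close>
    by (rule has_field_derivative_transform_within[where d=1])
      (auto simp: eq dist_real_def)
qed

lemma gateaux_le:
  assumes f: "f \<in> V" "f \<noteq> 0" and g: "g \<in> V"
  shows "gateaux f g \<le> N g"
proof (rule tendsto_upperbound)
  show "((\<lambda>t. (N (f + complex_of_real t *\<^sub>C g) - N f) / t) \<longlongrightarrow> gateaux f g) (at_right 0)"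
    using gateaux_DERIV[OF assms] by (auto simp: DERIV_def intro: tendsto_mono[OF at_le])
  have "(N (f + complex_of_real t *\<^sub>C g) - N f) / t \<le> N g" if "t > 0" for t
    using N_add[of f "complex_of_real t *\<^sub>C g"] N_scale[OF g, of "complex_of_real t"] f g that
    by (simp add: field_simps)
  then show "\<forall>\<^sub>F t in at_right 0. (N (f + complex_of_real t *\<^sub>C g) - N f) / t \<le> N g"
    by (auto simp: eventually_at_right_field intro: exI[of _ 1])
qed simp

lemma gateaux_scale_left:
  assumes f: "f \<in> V" "f \<noteq> 0" and g: "g \<in> V" and a: "a \<noteq> 0"
  shows "gateaux (a *\<^sub>C f) g = cmod a * gateaux f (inverse a *\<^sub>C g)"
proof (rule gateaux_eqI)
  have "a *\<^sub>C f + complex_of_real t *\<^sub>C g = a *\<^sub>C (f + complex_of_real t *\<^sub>C inverse a *\<^sub>C g)" for t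
    using a by (simp add: scaleC_add_right scaleC_scaleC)
  then have "N (a *\<^sub>C f + complex_of_real t *\<^sub>C g) = cmod a * N (f + complex_of_real t *\<^sub>C inverse a *\<^sub>C g)" for t
    using f g by (simp add: N_scale)
  then show "((\<lambda>t. N (a *\<^sub>C f + complex_of_real t *\<^sub>C g)) has_real_derivative
      cmod a * gateaux f (inverse a *\<^sub>C g)) (at 0)"
    using DERIV_cmult[OF gateaux_DERIV[OF f, of "inverse a *\<^sub>C g"], of "cmod a"] g by simp
qed

text \<open>By the Cauchy-Schwarz inequality \<open>?F\<close> below is minimal at 0, so its
  derivative vanishes there. Hence the norm determines the real part of any compatible semi-inner
  product.\<close>

lemma compatible_sip_Re:
  assumes s: "compatible_sip_on V N s" and f: "f \<in> V" "f \<noteq> 0" and g: "g \<in> V"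
  shows "Re (s g f) = N f * gateaux f g"
proof -
  note s' = s[unfolded compatible_sip_on_def semi_inner_product_on_def]
  let ?F = "\<lambda>t. N (f + complex_of_real t *\<^sub>C g) * N f - t * Re (s g f)"
  have deriv: "(?F has_real_derivative gateaux f g * N f - 1 * Re (s g f)) (at 0)"
    by (intro DERIV_diff DERIV_cmult_right DERIV_ident gateaux_DERIV f g)
  have min: "?F 0 \<le> ?F t" for t
  proof -
    have "0 < Re (s f f)" "sqrt (Re (s f f)) = N f" using s' f by auto
    then have ff: "Re (s f f) = N f * N f" by (metis less_imp_le real_sqrt_mult_self abs_of_nonneg)
    have "N f * N f + t * Re (s g f) = Re (s (f + complex_of_real t *\<^sub>C g) f)"
      using s' f g ff by simp
    also have "\<dots> \<le> cmod (s (f + complex_of_real t *\<^sub>C g) f)" by (rule complex_Re_le_cmod)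
    also have "\<dots> \<le> N (f + complex_of_real t *\<^sub>C g) * N f" using s' f g by (metis add_in scale_in)
    finally show ?thesis by simp
  qed
  have "gateaux f g * N f - 1 * Re (s g f) = 0"
    by (rule DERIV_local_min[OF deriv, of 1]) (use min in auto)
  then show ?thesis by (simp add: mult.commute)
qed

lemma compatible_sip_zero_right:
  assumes s: "compatible_sip_on V N s" and g: "g \<in> V"
  shows "s g 0 = 0"
proof -
  have "s g (0 *\<^sub>C 0) = cnj 0 * s g 0"
    using s g zero_in unfolding compatible_sip_on_def semi_inner_product_on_def by blast
  then show ?thesis by simp
qed

text \<open>The real part is known, and linearity in the first variable recovers the imaginary part
  from the real part at \<open>\<i> *\<^sub>C g\<close>.\<close>

lemma compatible_sip_unique:
  assumes s: "compatible_sip_on V N s" and s': "compatible_sip_on V N s'"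
    and f: "f \<in> V" and g: "g \<in> V"
  shows "s g f = s' g f"
proof (cases "f = 0")
  case True
  then show ?thesis using compatible_sip_zero_right[OF s g] compatible_sip_zero_right[OF s' g] by simp
next
  case False
  have Im: "Im (r g f) = - Re (r (\<i> *\<^sub>C g) f)" if "compatible_sip_on V N r" for r
  proof -
    have "r (\<i> *\<^sub>C g) f = \<i> * r g f"
      using that f g unfolding compatible_sip_on_def semi_inner_product_on_def by blast
    then show ?thesis by simp
  qed
  show ?thesis
    using compatible_sip_Re[OF s f False] compatible_sip_Re[OF s' f False] Im[OF s] Im[OF s'] g
    by (intro complex_eqI) auto
qed

text \<open>The imaginary part is the one forced by complex linearity in \<open>g\<close>. The value
  0 outside the carrier matches the normalization in \<open>sip\<close>.\<close>

definition gateaux_sip :: "'v \<Rightarrow> 'v \<Rightarrow> complex" where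
  "gateaux_sip g f = (if f \<in> V \<and> g \<in> V \<and> f \<noteq> 0
     then complex_of_real (N f) * Complex (gateaux f g) (- gateaux f (\<i> *\<^sub>C g)) else 0)"

lemma gateaux_sip_Re:
  "f \<in> V \<Longrightarrow> f \<noteq> 0 \<Longrightarrow> g \<in> V \<Longrightarrow> Re (gateaux_sip g f) = N f * gateaux f g"
  by (simp add: gateaux_sip_def)

lemma gateaux_sip_scale:
  assumes "f \<in> V" "g \<in> V"
  shows "gateaux_sip (a *\<^sub>C g) f = a * gateaux_sip g f"
proof (cases "f = 0")
  case False
  have "gateaux f ((\<i> * a) *\<^sub>C g) = - Im a * gateaux f g + Re a * gateaux f (\<i> *\<^sub>C g)"
    using gateaux_scale[OF assms(1) False assms(2), of "\<i> * a"] by simp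
  then show ?thesis
    using assms False gateaux_scale[OF assms(1) False assms(2), of a]
    by (intro complex_eqI) (simp_all only: gateaux_sip_def scale_in scaleC_scaleC, simp_all add: algebra_simps)
qed (simp add: gateaux_sip_def)

text \<open>\<open>gateaux_le\<close> controls real parts only. Multiplying \<open>g\<close> by the
  conjugate of the value makes the value real, and one factor of the modulus cancels.\<close>

lemma gateaux_sip_bound:
  assumes f: "f \<in> V" and g: "g \<in> V"
  shows "cmod (gateaux_sip g f) \<le> N g * N f"
proof (cases "gateaux_sip g f = 0")
  case True
  then show ?thesis using N_nonneg f g by simp
next
  case False
  let ?z = "gateaux_sip g f"
  have f0: "f \<noteq> 0" using False by (auto simp: gateaux_sip_def)
  have "cmod ?z * cmod ?z = Re (cnj ?z * ?z)"
    by (simp add: cmod_def flip: power2_eq_square)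
  also have "\<dots> = N f * gateaux f (cnj ?z *\<^sub>C g)"
    using gateaux_sip_Re[OF f f0, of "cnj ?z *\<^sub>C g"] gateaux_sip_scale[OF f g] g by simp
  also have "\<dots> \<le> N f * (cmod ?z * N g)"
    using gateaux_le[OF f f0, of "cnj ?z *\<^sub>C g"] g f N_nonneg by (simp add: N_scale mult_left_mono)
  finally show ?thesis using False by (simp add: mult.left_commute mult.commute)
qed

text \<open>The modulus is at most \<open>N f * N f\<close>, which the real part already attains, so
  no imaginary part is left.\<close>

lemma gateaux_sip_self:
  assumes "f \<in> V" "f \<noteq> 0"
  shows "gateaux_sip f f = complex_of_real (N f * N f)"
proof -
  let ?z = "gateaux_sip f f"
  have Re: "Re ?z = N f * N f" using gateaux_sip_Re gateaux_self assms by simp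
  have "(cmod ?z)\<^sup>2 \<le> (Re ?z)\<^sup>2"
    using gateaux_sip_bound[OF assms(1,1)] by (intro power_mono) (simp_all add: Re)
  then have "Im ?z = 0" by (simp add: cmod_power2)
  with Re show ?thesis by (intro complex_eqI) auto
qed

lemma gateaux_sip_scale_right:
  assumes f: "f \<in> V" and g: "g \<in> V"
  shows "gateaux_sip g (a *\<^sub>C f) = cnj a * gateaux_sip g f"
proof (cases "f = 0 \<or> a = 0")
  case True
  then show ?thesis by (auto simp: gateaux_sip_def)
next
  case False
  then have af: "a *\<^sub>C f \<noteq> 0" "a \<noteq> 0" "f \<noteq> 0" by auto
  \<comment> \<open>Scaling \<open>f\<close> by \<open>a\<close> contributes |a| from
    \<open>N\<close>, another |a| from the derivative, and \<open>inverse a\<close> on the first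
    argument; together they make up \<open>cnj a\<close>.\<close>
  have cnj: "cnj a = complex_of_real (cmod a * cmod a) * inverse a"
    using complex_norm_square[of a] af by (simp add: field_simps power2_eq_square)
  have Re_of_real_times: "Re (complex_of_real r * z) = r * Re z" for r z by simp
  have Re: "Re (gateaux_sip h (a *\<^sub>C f)) = Re (cnj a * gateaux_sip h f)" if h: "h \<in> V" for h
  proof -
    have "Re (gateaux_sip h (a *\<^sub>C f)) = (cmod a * cmod a) * Re (gateaux_sip (inverse a *\<^sub>C h) f)"
      using f af h by (simp add: gateaux_sip_Re gateaux_scale_left N_scale)
    also have "\<dots> = Re (complex_of_real (cmod a * cmod a) * (inverse a * gateaux_sip h f))"
      using gateaux_sip_scale[OF f h, of "inverse a"] by (simp only: Re_of_real_times)
    finally show ?thesis by (simp only: cnj mult.assoc)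
  qed
  have "Im z = - Re (\<i> * z)" for z by simp
  then have "Im (gateaux_sip g (a *\<^sub>C f)) = - Re (gateaux_sip (\<i> *\<^sub>C g) (a *\<^sub>C f))"
    using gateaux_sip_scale[of "a *\<^sub>C f" g \<i>] f g by simp
  also have "\<dots> = Im (cnj a * gateaux_sip g f)"
    using Re[of "\<i> *\<^sub>C g"] gateaux_sip_scale[OF f g, of \<i>] g by simp
  finally show ?thesis using Re[OF g] by (intro complex_eqI)
qed

lemma gateaux_sip_compatible: "compatible_sip_on V N gateaux_sip"
  unfolding compatible_sip_on_def semi_inner_product_on_def
proof (intro conjI ballI allI impI)
  fix f g h assume fgh: "f \<in> V" "g \<in> V" "h \<in> V"
  then show "gateaux_sip (f + g) h = gateaux_sip f h + gateaux_sip g h"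
    by (intro complex_eqI)
      (simp_all add: gateaux_sip_def gateaux_add scaleC_add_right algebra_simps)
next
  have sq: "sqrt (Re (gateaux_sip f f)) = N f" if "f \<in> V" for f
    using gateaux_sip_self[OF that] N_nonneg[OF that] by (cases "f = 0") (auto simp: gateaux_sip_def)
  then show "f \<in> V \<Longrightarrow> sqrt (Re (gateaux_sip f f)) = N f" for f .
  show "cmod (gateaux_sip f g) \<le> sqrt (Re (gateaux_sip f f)) * sqrt (Re (gateaux_sip g g))"
    if "f \<in> V" "g \<in> V" for f g
    using gateaux_sip_bound sq that by simp
qed (use gateaux_sip_scale gateaux_sip_scale_right gateaux_sip_self N_pos in auto)

text \<open>Existence and uniqueness, which make the description in \<open>sip\<close>
  denote.\<close>

lemma sip_eq_gateaux_sip: "sip V N = gateaux_sip"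
  unfolding sip_def
proof (rule the_equality)
  show "compatible_sip_on V N gateaux_sip \<and> (\<forall>f g. f \<notin> V \<or> g \<notin> V \<longrightarrow> gateaux_sip f g = 0)"
    using gateaux_sip_compatible by (auto simp: gateaux_sip_def)
  fix s assume s: "compatible_sip_on V N s \<and> (\<forall>f g. f \<notin> V \<or> g \<notin> V \<longrightarrow> s f g = 0)"
  show "s = gateaux_sip"
  proof (intro ext)
    fix g f show "s g f = gateaux_sip g f"
      using s compatible_sip_unique[OF _ gateaux_sip_compatible]
      by (cases "f \<in> V \<and> g \<in> V") (auto simp: gateaux_sip_def)
  qed
qed

lemma sip_compatible: "compatible_sip_on V N (sip V N)"
  by (simp add: sip_eq_gateaux_sip gateaux_sip_compatible)

lemma dual_elem_in_dual_space: "f \<in> V \<Longrightarrow> dual_elem V N f \<in> dual_space V N"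
  using sip_compatible gateaux_sip_bound[of f]
  unfolding dual_space_def dual_elem_def compatible_sip_on_def semi_inner_product_on_def
  by (auto simp: sip_eq_gateaux_sip gateaux_sip_def mult.commute intro!: exI[of _ "N f"])

lemma sip_self_eq_0: "f \<in> V \<Longrightarrow> sip V N f f = 0 \<longleftrightarrow> f = 0"
  using gateaux_sip_self[of f] N_eq_0[of f] by (cases "f = 0") (auto simp: sip_eq_gateaux_sip gateaux_sip_def)

text \<open>Minimality makes the derivative of the norm at \<open>f\<close> vanish along
  \<open>W\<close>, which handles real parts. As \<open>W\<close> is a complex subspace, the
  direction \<open>\<i> *\<^sub>C g\<close> handles imaginary parts.\<close>

lemma dual_elem_orthogonal:
  assumes f: "f \<in> V" and W: "complex_vector.subspace W" "W \<subseteq> V"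
    and min: "\<And>g. g \<in> W \<Longrightarrow> N f \<le> N (f + g)" and g: "g \<in> W"
  shows "dual_elem V N f g = 0"
proof (cases "f = 0")
  case True
  then show ?thesis by (simp add: dual_elem_def sip_eq_gateaux_sip gateaux_sip_def)
next
  case False
  have Re: "Re (gateaux_sip h f) = 0" if h: "h \<in> W" for h
  proof -
    have hV: "h \<in> V" using h W by auto
    have "N (f + complex_of_real 0 *\<^sub>C h) \<le> N (f + complex_of_real t *\<^sub>C h)" for t
      using min complex_vector.subspace_scale[OF W(1) h] by simp
    then have "gateaux f h = 0"
      using DERIV_local_min[OF gateaux_DERIV[OF f False hV], of 1] by simp
    then show ?thesis using gateaux_sip_Re[OF f False hV] by simp
  qed
  have "gateaux_sip (\<i> *\<^sub>C g) f = \<i> * gateaux_sip g f"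
    using gateaux_sip_scale f g W by auto
  then have "Im (gateaux_sip g f) = 0"
    using Re[OF complex_vector.subspace_scale[OF W(1) g, of \<i>]] by simp
  then show ?thesis
    using Re[OF g] by (simp add: dual_elem_def sip_eq_gateaux_sip complex_eq_iff)
qed

subsection \<open>Minimal norm modulo the annihilator of a set of functionals\<close>

definition annihilator :: "('v \<Rightarrow> complex) set \<Rightarrow> 'v set" where
  "annihilator S = {g \<in> V. \<forall>\<mu>\<in>S. \<mu> g = 0}"

lemma annihilator_subspace:
  assumes "S \<subseteq> dual_space V N"
  shows "complex_vector.subspace (annihilator S)"
  using assms
  by (intro complex_vector.subspaceI)
    (auto simp: annihilator_def subset_iff dual_zero dual_add dual_scale)

lemma annihilator_closed:
  assumes S: "S \<subseteq> dual_space V N" and u: "\<And>n::nat. u n \<in> annihilator S"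
    and l: "l \<in> V" "(\<lambda>n. N (u n - l)) \<longlonglongrightarrow> 0"
  shows "l \<in> annihilator S"
proof -
  have "\<mu> l = 0" if \<mu>: "\<mu> \<in> S" for \<mu>
  proof -
    have \<mu>D: "\<mu> \<in> dual_space V N" using \<mu> S by auto
    have "cmod (\<mu> l) \<le> dual_norm V N \<mu> * N (u n - l)" for n
    proof -
      have "u n \<in> V" "\<mu> (u n) = 0" using u[of n] \<mu> by (auto simp: annihilator_def)
      then show ?thesis
        using dual_norm_ge[OF \<mu>D, of "u n - l"] dual_diff[OF \<mu>D, of "u n" l] l(1) by simp
    qed
    then have "cmod (\<mu> l) \<le> dual_norm V N \<mu> * 0"
      by (intro LIMSEQ_le_const[OF tendsto_mult_left[OF l(2)]]) auto
    then show ?thesis by simp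
  qed
  then show ?thesis using l by (simp add: annihilator_def)
qed

lemma min_norm_mod_annihilator:
  assumes "S \<subseteq> dual_space V N" "f \<in> V"
  obtains f\<^sub>0 where "f\<^sub>0 \<in> V" "f - f\<^sub>0 \<in> annihilator S"
    "\<And>g. g \<in> annihilator S \<Longrightarrow> N f\<^sub>0 \<le> N (f\<^sub>0 + g)"
proof (rule min_norm_in_coset[OF assms(2) annihilator_subspace[OF assms(1)]])
  show "annihilator S \<subseteq> V" by (auto simp: annihilator_def)
qed (use that annihilator_closed[OF assms(1)] in blast)+

text \<open>Joins the two halves: minimality makes the functional of \<open>f\<close> vanish on the
  common kernel of \<open>S\<close>, and separation then places it in the closed span.\<close>

lemma dual_elem_in_dual_closed_span:
  assumes S: "S \<subseteq> dual_space V N" and f: "f \<in> V"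
    and min: "\<And>g. g \<in> annihilator S \<Longrightarrow> N f \<le> N (f + g)"
  shows "dual_elem V N f \<in> dual_closed_span V N S"
proof (rule in_dual_closed_span[OF dual_elem_in_dual_space[OF f] S])
  fix u assume "u \<in> V" "\<And>\<mu>. \<mu> \<in> S \<Longrightarrow> \<mu> u = 0"
  then show "dual_elem V N f u = 0"
    by (intro dual_elem_orthogonal[OF f annihilator_subspace[OF S] _ min]) (auto simp: annihilator_def)
qed

end

section \<open>The representer theorem\<close>

theorem theorem5p7:
  fixes B :: "('x \<Rightarrow> 'l::complex_banach) set"
    and normB :: "('x \<Rightarrow> 'l) \<Rightarrow> real"
    and K :: "'x \<Rightarrow> 'x \<Rightarrow> 'l \<Rightarrow> 'l"
    and m :: nat
    and xs :: "'x list"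
    and Q :: "'l list \<Rightarrow> real"
    and \<Psi> :: "real \<Rightarrow> real"
    and lam :: real
  assumes "RKBS B normB"
    and "reproducing_kernel B normB K"
    and "length xs = m"
    and "Q \<in> {v. length v = m} \<rightarrow> {0..}"
    and "\<Psi> \<in> {0..} \<rightarrow> {0..}"
    and "lam > 0"
    and "\<exists>f. is_arg_min (objective Q lam \<Psi> normB xs) (\<lambda>f. f \<in> B) f"
  shows "(mono_on {0..} \<Psi> \<longrightarrow>
           (\<exists>f\<^sub>0. is_arg_min (objective Q lam \<Psi> normB xs) (\<lambda>f. f \<in> B) f\<^sub>0 \<and>
              dual_elem B normB f\<^sub>0 \<in> dual_closed_span B normB
                {dual_elem B normB (\<lambda>y. K (xs ! j) y \<xi>) | j \<xi>. j < m}))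
       \<and> (strict_mono_on {0..} \<Psi> \<longrightarrow>
           (\<forall>f\<^sub>0. is_arg_min (objective Q lam \<Psi> normB xs) (\<lambda>f. f \<in> B) f\<^sub>0 \<longrightarrow>
              dual_elem B normB f\<^sub>0 \<in> dual_closed_span B normB
                {dual_elem B normB (\<lambda>y. K (xs ! j) y \<xi>) | j \<xi>. j < m}))"
proof -
  let ?S = "{dual_elem B normB (\<lambda>y. K (xs ! j) y \<xi>) | j \<xi>. j < m}"
  let ?J = "objective Q lam \<Psi> normB xs"
  interpret B: uniform_carrier B normB
    using assms(1) by unfold_locales (simp add: RKBS_def)
  interpret L: uniform_carrier "UNIV :: 'l set" norm
    using assms(1) by unfold_locales (simp add: RKBS_def)
  have K: "(\<lambda>y. K x y \<xi>) \<in> B"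
    "f \<in> B \<Longrightarrow> sip UNIV norm (f x) \<xi> = dual_elem B normB (\<lambda>y. K x y \<xi>) f" for f x \<xi>
    using assms(2) by (simp_all add: reproducing_kernel_def dual_elem_def)
  have S: "?S \<subseteq> dual_space B normB"
    using B.dual_elem_in_dual_space K(1) by auto
  have ann: "g x = 0" if g: "g \<in> B.annihilator ?S" and x: "x \<in> set xs" for g x
  proof -
    obtain j where j: "j < m" "x = xs ! j" using x assms(3) by (auto simp: in_set_conv_nth)
    \<comment> \<open>Taking \<xi> = g x turns the reproducing identity into
      \<open>[g x, g x] = 0\<close>.\<close>
    then have "dual_elem B normB (\<lambda>y. K x y (g x)) g = 0"
      using g by (auto simp: B.annihilator_def)
    then have "sip UNIV norm (g x) (g x) = 0"
      using K(2) g by (simp add: B.annihilator_def)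
    then show ?thesis by (simp add: L.sip_self_eq_0)
  qed
  then have Q: "map (f + g) xs = map f xs" if "g \<in> B.annihilator ?S" for f g
    using that by simp
  show ?thesis
  proof (intro conjI impI allI)
    assume mono: "mono_on {0..} \<Psi>"
    obtain f where f: "f \<in> B" "\<And>h. h \<in> B \<Longrightarrow> ?J f \<le> ?J h"
      using assms(7) by (auto simp: is_arg_min_linorder)
    obtain f\<^sub>0 where f\<^sub>0: "f\<^sub>0 \<in> B" "f - f\<^sub>0 \<in> B.annihilator ?S"
      "\<And>g. g \<in> B.annihilator ?S \<Longrightarrow> normB f\<^sub>0 \<le> normB (f\<^sub>0 + g)"
      using B.min_norm_mod_annihilator[OF S f(1)] by blast
    \<comment> \<open>The original minimizer is \<open>f\<^sub>0\<close> plus the annihilator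
      element \<open>f - f\<^sub>0\<close>, so it is no shorter and has the same values at the
      points of \<open>xs\<close>.\<close>
    have "normB f\<^sub>0 \<le> normB f" using f\<^sub>0(3)[OF f\<^sub>0(2)] by simp
    then have "\<Psi> (normB f\<^sub>0) \<le> \<Psi> (normB f)"
      using mono f f\<^sub>0 B.N_nonneg by (auto simp: mono_on_def)
    moreover have "map f xs = map f\<^sub>0 xs" using Q[OF f\<^sub>0(2), of f\<^sub>0] by simp
    ultimately have le: "?J f\<^sub>0 \<le> ?J f"
      unfolding objective_def using assms(6) by (simp only: add_le_cancel_left mult_le_cancel_left_pos)
    have "?J f\<^sub>0 \<le> ?J h" if "h \<in> B" for h using le f(2)[OF that] by simp
    then have "is_arg_min ?J (\<lambda>f. f \<in> B) f\<^sub>0" using f\<^sub>0(1) by (simp add: is_arg_min_linorder)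
    then show "\<exists>f\<^sub>0. is_arg_min ?J (\<lambda>f. f \<in> B) f\<^sub>0 \<and> dual_elem B normB f\<^sub>0 \<in> dual_closed_span B normB ?S"
      using B.dual_elem_in_dual_closed_span[OF S f\<^sub>0(1,3)] by blast
  next
    fix f assume mono: "strict_mono_on {0..} \<Psi>" and "is_arg_min ?J (\<lambda>f. f \<in> B) f"
    then have f: "f \<in> B" "\<And>h. h \<in> B \<Longrightarrow> ?J f \<le> ?J h" by (auto simp: is_arg_min_linorder)
    show "dual_elem B normB f \<in> dual_closed_span B normB ?S"
    \<comment> \<open>Here the minimizer itself must be shortest in its coset: a shorter
      \<open>f + g\<close> would have the same loss and a strictly smaller penalty.\<close>
    proof (rule B.dual_elem_in_dual_closed_span[OF S f(1)], rule ccontr)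
      fix g assume g: "g \<in> B.annihilator ?S" and less: "\<not> normB f \<le> normB (f + g)"
      have fg: "f + g \<in> B" using f g by (simp add: B.annihilator_def)
      then have "\<Psi> (normB (f + g)) < \<Psi> (normB f)"
        using strict_mono_onD[OF mono] less f(1) B.N_nonneg by simp
      then have "?J (f + g) < ?J f" unfolding objective_def Q[OF g] using assms(6) by simp
      then show False using f(2)[OF fg] by simp
    qed
  qed
qed

end
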